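(* Let $\Gamma$ be a finite connected graph on $k\geq 1$ vertices, let $n\geq 1$ be an integer, and let $\Gamma_n$ be the $n$th cone over $\Gamma$, i.e. the join of $\Gamma$ with the complete graph $K_n$. Then there is a short exact sequence of abelian groups \[ 0 \to (\mathbb{Z}/(n+k)\mathbb{Z})^{n-1} \to \operatorname{Pic}^0(\Gamma_n) \to H_n \to 0 \] in which the abelian group $H_n$ has order $|P_{\Gamma}(-n)|$, where $P_{\Gamma}(x)$ is the characteristic polynomial of the rational Laplacian operator of $\Gamma$.
   Context: All graphs are finite, non-empty and connected. The join of two graphs $\Gamma_1,\Gamma_2$ is obtained from their disjoint union by joining every vertex of $\Gamma_1$ to every vertex of $\Gamma_2$ by an edge. For a graph $\Gamma$, $\operatorname{Div}(\Gamma)$ is the free abelian group on the vertex set $V(\Gamma)$, and $\operatorname{Div}^0(\Gamma)$ is the kernel of the degree map $\sum a_v v\mapsto \sum a_v$. The Laplacian operator $\Delta(\Gamma):\operatorname{Div}(\Gamma)\to\operatorname{Div}^0(\Gamma)$ is defined on the basis by $v\mapsto (\deg v)\,v-\sum_{wv\in E(\Gamma)} w$. The chip-firing group is $\operatorname{Pic}^0(\Gamma)=\operatorname{Div}^0(\Gamma)/\operatorname{im}\Delta(\Gamma)$. The rational Laplacian operator is the linear endomorphism of $\operatorname{Div}^0(\Gamma)\otimes_{\mathbb{Z}}\mathbb{Q}$ induced by $\Delta(\Gamma)$, and $P_\Gamma(x)$ denotes its characteristic polynomial (of degree $|V(\Gamma)|-1$), with the convention $P_\Gamma(x)=1$ if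 $\Gamma$ has only one vertex. *)

theory Defs
  imports
    "HOL-Algebra.Free_Abelian_Groups"
    "HOL-Algebra.Exact_Sequence"
    "Graph_Theory.Kuratowski"
    "Jordan_Normal_Form.Char_Poly"
begin

text \<open>
  A finite simple undirected graph is a \<^typ>\<open>'a pair_pre_digraph\<close> satisfying
  \<^const>\<open>pair_graph\<close>: each edge is represented by its two opposite arcs, so the degree of a
  vertex is its \<^const>\<open>out_degree\<close>.
\<close>

definition graph_join ::
    "'a pair_pre_digraph \<Rightarrow> 'b pair_pre_digraph \<Rightarrow> ('a + 'b) pair_pre_digraph" where
  "graph_join G H =
     \<lparr> pverts = pverts G <+> pverts H,
       parcs = map_prod Inl Inl ` parcs G \<union> map_prod Inr Inr ` parcs H
             \<union> Inl ` pverts G \<times> Inr ` pverts H \<union> Inr ` pverts H \<times> Inl ` pverts G \<rparr>"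

definition Div :: "'a pair_pre_digraph \<Rightarrow> ('a \<Rightarrow>\<^sub>0 int) monoid" where
  "Div G = free_Abelian_group (pverts G)"

definition div_degree :: "('a \<Rightarrow>\<^sub>0 'b::comm_monoid_add) \<Rightarrow> 'b" where
  "div_degree D = (\<Sum>v\<in>Poly_Mapping.keys D. Poly_Mapping.lookup D v)"

definition Div0 :: "'a pair_pre_digraph \<Rightarrow> ('a \<Rightarrow>\<^sub>0 int) monoid" where
  "Div0 G = (Div G)\<lparr>carrier := kernel (Div G) integer_group div_degree\<rparr>"

definition laplacian :: "'a pair_pre_digraph \<Rightarrow> ('a \<Rightarrow>\<^sub>0 int) \<Rightarrow> ('a \<Rightarrow>\<^sub>0 int)" where
  "laplacian G =
     frag_extend (\<lambda>v. frag_cmul (int (out_degree (with_proj G) v)) (frag_of v)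
                     - (\<Sum>w | (w, v) \<in> parcs G. frag_of w))"

definition Pic0 :: "'a pair_pre_digraph \<Rightarrow> ('a \<Rightarrow>\<^sub>0 int) set monoid" where
  "Pic0 G = Div0 G Mod (laplacian G ` carrier (Div G))"

text \<open>
  \<open>Div0 G \<otimes> \<rat>\<close> is realised as the space of rational divisors of degree \<open>0\<close>, an integral divisor
  \<open>D\<close> being identified with \<open>rat_of_div D\<close>. The facts \<open>inj_rat_of_div\<close>, \<open>rat_of_div_add\<close>,
  \<open>rat_of_div_Div0\<close> and \<open>rat_Div0_clear_denominators\<close> below show that this is the
  rationalisation of \<open>Div0 G\<close>, and \<open>linear_rat_laplacian\<close> and \<open>rat_laplacian_rat_of_div\<close> that
  \<open>rat_laplacian G\<close> is the endomorphism induced by \<open>laplacian G\<close>.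
\<close>

definition rat_scale :: "rat \<Rightarrow> ('a \<Rightarrow>\<^sub>0 rat) \<Rightarrow> ('a \<Rightarrow>\<^sub>0 rat)" where
  "rat_scale c = Poly_Mapping.map ((*) c)"

definition rat_of_div :: "('a \<Rightarrow>\<^sub>0 int) \<Rightarrow> ('a \<Rightarrow>\<^sub>0 rat)" where
  "rat_of_div = Poly_Mapping.map of_int"

definition rat_Div0 :: "'a pair_pre_digraph \<Rightarrow> ('a \<Rightarrow>\<^sub>0 rat) set" where
  "rat_Div0 G = {D. Poly_Mapping.keys D \<subseteq> pverts G \<and> div_degree D = 0}"

definition rat_laplacian :: "'a pair_pre_digraph \<Rightarrow> ('a \<Rightarrow>\<^sub>0 rat) \<Rightarrow> ('a \<Rightarrow>\<^sub>0 rat)" where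
  "rat_laplacian G D =
     (\<Sum>v\<in>Poly_Mapping.keys D. rat_scale (Poly_Mapping.lookup D v)
        (Poly_Mapping.single v (of_nat (out_degree (with_proj G) v))
         - (\<Sum>w | (w, v) \<in> parcs G. Poly_Mapping.single w 1)))"

text \<open>
  The characteristic polynomial of an endomorphism \<open>T\<close> of a finite-dimensional subspace \<open>W\<close> is
  that of the matrix of \<open>T\<close> in a basis of \<open>W\<close>; it does not depend on the basis
  (\<open>endo_char_poly_eq\<close>). For \<open>W = {0}\<close> the basis is empty and the polynomial is \<open>1\<close>.
\<close>

definition represents ::
    "('k::field \<Rightarrow> 'v::ab_group_add \<Rightarrow> 'v) \<Rightarrow> 'v set \<Rightarrow> ('v \<Rightarrow> 'v) \<Rightarrow> 'v list \<Rightarrow> 'k mat \<Rightarrow> bool" where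
  "represents scale W T bs A \<longleftrightarrow>
     distinct bs \<and> \<not> module.dependent scale (set bs) \<and> module.span scale (set bs) = W
     \<and> A \<in> carrier_mat (length bs) (length bs)
     \<and> (\<forall>j<length bs. T (bs ! j) = (\<Sum>i<length bs. scale (A $$ (i, j)) (bs ! i)))"

definition endo_char_poly ::
    "('k::field \<Rightarrow> 'v::ab_group_add \<Rightarrow> 'v) \<Rightarrow> 'v set \<Rightarrow> ('v \<Rightarrow> 'v) \<Rightarrow> 'k poly" where
  "endo_char_poly scale W T = (THE p. \<exists>bs A. represents scale W T bs A \<and> p = char_poly A)"

definition laplacian_char_poly :: "'a pair_pre_digraph \<Rightarrow> rat poly" where
  "laplacian_char_poly G = endo_char_poly rat_scale (rat_Div0 G) (rat_laplacian G)"

text \<open>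
  \<^const>\<open>short_exact_sequence\<close> forces all groups to have the same element type; this is the
  heterogeneous version for abelian groups, with the arrows pointing from left to right.
\<close>

definition short_exact_comm_groups ::
    "'a monoid \<Rightarrow> ('a \<Rightarrow> 'b) \<Rightarrow> 'b monoid \<Rightarrow> ('b \<Rightarrow> 'c) \<Rightarrow> 'c monoid \<Rightarrow> bool" where
  "short_exact_comm_groups A f B g C \<longleftrightarrow>
     comm_group A \<and> comm_group B \<and> comm_group C
     \<and> f \<in> mon A B \<and> g \<in> epi B C \<and> f ` carrier A = kernel B C g"


subsection \<open>Well-definedness\<close>

lemma lookup_rat_scale [simp]:
  "Poly_Mapping.lookup (rat_scale c D) v = c * Poly_Mapping.lookup D v"
  unfolding rat_scale_def by (simp add: Poly_Mapping.map.rep_eq when_def)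

lemma lookup_rat_of_div [simp]:
  "Poly_Mapping.lookup (rat_of_div D) v = of_int (Poly_Mapping.lookup D v)"
  unfolding rat_of_div_def by (simp add: Poly_Mapping.map.rep_eq when_def)

interpretation rat_vs: vector_space rat_scale
  by unfold_locales (auto intro!: poly_mapping_eqI simp: lookup_add algebra_simps)

lemma lookup_sum_pm:
  "Poly_Mapping.lookup (\<Sum>i\<in>I. f i) v = (\<Sum>i\<in>I. Poly_Mapping.lookup (f i) v)"
  by (induction I rule: infinite_finite_induct) (auto simp: lookup_add)

lemma div_degree_eq:
  assumes "finite S" "Poly_Mapping.keys D \<subseteq> S"
  shows "div_degree D = (\<Sum>v\<in>S. Poly_Mapping.lookup D v)"
  unfolding div_degree_def using assms
  by (intro sum.mono_neutral_left) (auto simp: in_keys_iff)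

lemma div_degree_add: "div_degree (D + E) = div_degree D + div_degree E"
proof -
  let ?S = "Poly_Mapping.keys D \<union> Poly_Mapping.keys E"
  have "div_degree (D + E) = (\<Sum>v\<in>?S. Poly_Mapping.lookup (D + E) v)"
    using Poly_Mapping.keys_add[of D E] by (intro div_degree_eq) auto
  also have "\<dots> = (\<Sum>v\<in>?S. Poly_Mapping.lookup D v) + (\<Sum>v\<in>?S. Poly_Mapping.lookup E v)"
    by (simp add: lookup_add sum.distrib)
  also have "\<dots> = div_degree D + div_degree E"
    by (simp add: div_degree_eq[of ?S D] div_degree_eq[of ?S E])
  finally show ?thesis .
qed

lemma div_degree_0 [simp]: "div_degree 0 = 0"
  by (simp add: div_degree_def)

lemma div_degree_uminus: "div_degree (- D) = - div_degree (D :: 'a \<Rightarrow>\<^sub>0 'b::ab_group_add)"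
  using div_degree_add[of D "- D"] by (simp add: eq_neg_iff_add_eq_0 add.commute)

lemma div_degree_diff:
  "div_degree (D - E) = div_degree D - div_degree (E :: 'a \<Rightarrow>\<^sub>0 'b::ab_group_add)"
  using div_degree_add[of D "- E"] by (simp add: div_degree_uminus)

lemma div_degree_sum: "div_degree (\<Sum>i\<in>I. f i) = (\<Sum>i\<in>I. div_degree (f i))"
  by (induction I rule: infinite_finite_induct) (auto simp: div_degree_add)

lemma div_degree_single [simp]: "div_degree (Poly_Mapping.single v c) = c"
  by (simp add: div_degree_def)

lemma keys_rat_scale: "Poly_Mapping.keys (rat_scale c D) \<subseteq> Poly_Mapping.keys D"
  by (auto simp: in_keys_iff)

lemma div_degree_rat_scale: "div_degree (rat_scale c D) = c * div_degree D"
  using div_degree_eq[OF finite_keys keys_rat_scale, of c D]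
  by (simp add: div_degree_def sum_distrib_left)

lemma keys_rat_of_div [simp]: "Poly_Mapping.keys (rat_of_div D) = Poly_Mapping.keys D"
  by (auto simp: in_keys_iff)

lemma div_degree_rat_of_div: "div_degree (rat_of_div D) = of_int (div_degree D)"
  by (simp add: div_degree_def)

lemma inj_rat_of_div: "inj rat_of_div"
  by (auto intro!: injI poly_mapping_eqI simp: poly_mapping_eq_iff fun_eq_iff)

lemma rat_of_div_add: "rat_of_div (D + E) = rat_of_div D + rat_of_div E"
  by (auto intro!: poly_mapping_eqI simp: lookup_add)

lemma carrier_Div0:
  "D \<in> carrier (Div0 G) \<longleftrightarrow> Poly_Mapping.keys D \<subseteq> pverts G \<and> div_degree D = 0"
  by (auto simp: Div0_def Div_def kernel_def integer_group_def)

lemma rat_of_div_Div0: "rat_of_div D \<in> rat_Div0 G \<longleftrightarrow> D \<in> carrier (Div0 G)"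
  by (simp add: rat_Div0_def carrier_Div0 div_degree_rat_of_div)

lemma common_denominator:
  fixes f :: "'a \<Rightarrow> rat"
  assumes "finite S"
  shows "\<exists>m::int. m > 0 \<and> (\<forall>v\<in>S. of_int m * f v \<in> \<int>)"
  using assms
proof (induction S rule: finite_induct)
  case empty
  show ?case by (intro exI[of _ 1]) auto
next
  case (insert x F)
  then obtain m :: int where m: "m > 0" "\<forall>v\<in>F. of_int m * f v \<in> \<int>" by blast
  obtain a b where ab: "quotient_of (f x) = (a, b)" by fastforce
  have b: "b > 0" "f x = of_int a / of_int b"
    using ab quotient_of_denom_pos quotient_of_div by blast+
  have "of_int (b * m) * f x = of_int (m * a)"
    using b by simp
  hence "of_int (b * m) * f x \<in> \<int>" by (metis Ints_of_int)
  moreover have "of_int (b * m) * f v \<in> \<int>" if "v \<in> F" for v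
  proof -
    have "of_int (b * m) * f v = of_int b * (of_int m * f v)" by simp
    thus ?thesis using m that by (metis Ints_mult Ints_of_int)
  qed
  ultimately show ?case using m b
    by (intro exI[of _ "b * m"]) auto
qed

lemma subspace_rat_Div0: "rat_vs.subspace (rat_Div0 G)"
proof (rule rat_vs.subspaceI)
  fix D E c assume D: "D \<in> rat_Div0 G"
  show "rat_scale c D \<in> rat_Div0 G"
    using D keys_rat_scale[of c D] by (auto simp: rat_Div0_def div_degree_rat_scale)
  assume "E \<in> rat_Div0 G"
  thus "D + E \<in> rat_Div0 G"
    using D Poly_Mapping.keys_add[of D E] by (auto simp: rat_Div0_def div_degree_add)
qed (simp add: rat_Div0_def)

lemma rat_Div0_clear_denominators:
  assumes "D \<in> rat_Div0 G"
  shows "\<exists>m::int. \<exists>E\<in>carrier (Div0 G). m > 0 \<and> rat_scale (of_int m) D = rat_of_div E"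
proof -
  obtain m :: int where m: "m > 0"
      "\<forall>v\<in>Poly_Mapping.keys D. of_int m * Poly_Mapping.lookup D v \<in> \<int>"
    using common_denominator[of "Poly_Mapping.keys D" "Poly_Mapping.lookup D"] by auto
  define E :: "'a \<Rightarrow>\<^sub>0 int" where "E = Poly_Mapping.map (\<lambda>x. \<lfloor>of_int m * x\<rfloor>) D"
  have "rat_scale (of_int m) D = rat_of_div E"
  proof (rule poly_mapping_eqI)
    fix v
    show "Poly_Mapping.lookup (rat_scale (of_int m) D) v = Poly_Mapping.lookup (rat_of_div E) v"
      using m by (cases "v \<in> Poly_Mapping.keys D")
        (auto simp: E_def Poly_Mapping.map.rep_eq when_def in_keys_iff elim!: Ints_cases)
  qed
  moreover have "rat_scale (of_int m) D \<in> rat_Div0 G"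
    using assms by (rule rat_vs.subspace_scale[OF subspace_rat_Div0])
  ultimately show ?thesis using m rat_of_div_Div0[of E G] by auto
qed

lemma rat_laplacian_eq:
  assumes "finite S" "Poly_Mapping.keys D \<subseteq> S"
  shows "rat_laplacian G D =
     (\<Sum>v\<in>S. rat_scale (Poly_Mapping.lookup D v)
        (Poly_Mapping.single v (of_nat (out_degree (with_proj G) v))
         - (\<Sum>w | (w, v) \<in> parcs G. Poly_Mapping.single w 1)))"
  unfolding rat_laplacian_def using assms
  by (intro sum.mono_neutral_left) (auto simp: in_keys_iff)

lemma linear_rat_laplacian: "Vector_Spaces.linear rat_scale rat_scale (rat_laplacian G)"
proof
  fix D E :: "'a \<Rightarrow>\<^sub>0 rat" and c
  let ?S = "Poly_Mapping.keys D \<union> Poly_Mapping.keys E"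
  show "rat_laplacian G (D + E) = rat_laplacian G D + rat_laplacian G E"
    using Poly_Mapping.keys_add[of D E]
    by (simp add: rat_laplacian_eq[of ?S] lookup_add rat_vs.scale_left_distrib sum.distrib)
  show "rat_laplacian G (rat_scale c D) = rat_scale c (rat_laplacian G D)"
    using keys_rat_scale[of c D]
    by (simp add: rat_laplacian_eq[of "Poly_Mapping.keys D"] rat_vs.scale_sum_right)
qed

lemma rat_laplacian_rat_of_div: "rat_laplacian G (rat_of_div D) = rat_of_div (laplacian G D)"
proof (rule poly_mapping_eqI)
  fix u
  have "of_int (\<Sum>w | (w, v) \<in> parcs G. if u = w then 1 else 0)
      = (\<Sum>w | (w, v) \<in> parcs G. if w = u then 1 else (0::rat))" for v
    unfolding of_int_sum by (intro sum.cong) auto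
  thus "Poly_Mapping.lookup (rat_laplacian G (rat_of_div D)) u
      = Poly_Mapping.lookup (rat_of_div (laplacian G D)) u"
    unfolding rat_laplacian_def laplacian_def frag_extend_def
    by (auto intro!: sum.cong simp: lookup_sum_pm lookup_minus lookup_single when_def)
qed

lemma (in pair_graph) out_degree_eq_card: "out_degree (with_proj G) v = card {w. (w, v) \<in> parcs G}"
proof -
  have "out_arcs (with_proj G) v = Pair v ` {w. (w, v) \<in> parcs G}"
    using pair_sym_arcs by (auto simp: out_arcs_def symmetric_def sym_def)
  thus ?thesis unfolding out_degree_def by (simp add: card_image inj_on_def)
qed

lemma (in pair_graph) rat_laplacian_in_rat_Div0:
  assumes "Poly_Mapping.keys D \<subseteq> pverts G"
  shows "rat_laplacian G D \<in> rat_Div0 G"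
proof -
  have "rat_scale c (Poly_Mapping.single v (of_nat (out_degree (with_proj G) v))
         - (\<Sum>w | (w, v) \<in> parcs G. Poly_Mapping.single w 1)) \<in> rat_Div0 G"
    if "v \<in> pverts G" for v c
  proof -
    have "u \<in> pverts G" if "c * (Poly_Mapping.lookup (Poly_Mapping.single v (of_nat (out_degree (with_proj G) v))
         - (\<Sum>w | (w, v) \<in> parcs G. Poly_Mapping.single w (1::rat))) u) \<noteq> 0" for u
    proof (rule ccontr)
      assume u: "u \<notin> pverts G"
      hence "u \<noteq> v" "(u, v) \<notin> parcs G" using \<open>v \<in> pverts G\<close> in_arcsD1 by auto
      hence "(\<Sum>w | (w, v) \<in> parcs G. Poly_Mapping.lookup (Poly_Mapping.single w (1::rat)) u) = 0"
        by (intro sum.neutral) (auto simp: lookup_single when_def)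
      thus False using that \<open>u \<noteq> v\<close> by (simp add: lookup_minus lookup_sum_pm lookup_single)
    qed
    thus ?thesis
      by (auto simp: rat_Div0_def div_degree_rat_scale div_degree_diff div_degree_sum
          out_degree_eq_card in_keys_iff)
  qed
  thus ?thesis unfolding rat_laplacian_def using assms
    by (intro rat_vs.subspace_sum[OF subspace_rat_Div0]) auto
qed

lemma (in pair_graph) laplacian_in_Div0:
  assumes "D \<in> carrier (Div G)"
  shows "laplacian G D \<in> carrier (Div0 G)"
  using rat_laplacian_in_rat_Div0[of "rat_of_div D"] assms
  by (simp add: rat_laplacian_rat_of_div rat_of_div_Div0 Div_def)

context vector_space
begin

lemma sum_list_coords:
  assumes "distinct bs"
  shows "(\<Sum>i<length bs. scale (c (bs ! i)) (bs ! i)) = (\<Sum>b\<in>set bs. scale (c b) b)"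
  using assms by (intro sum.reindex_bij_betw[OF bij_betw_nth]) auto

lemma basis_list_unique:
  assumes "distinct bs" "independent (set bs)"
    and "(\<Sum>i<length bs. scale (a i) (bs ! i)) = (\<Sum>i<length bs. scale (b i) (bs ! i))"
    and "i < length bs"
  shows "a i = b i"
proof -
  let ?ix = "the_inv_into {..<length bs} ((!) bs)"
  have inj: "inj_on ((!) bs) {..<length bs}" using assms(1) by (simp add: inj_on_nth)
  have ix: "?ix (bs ! j) = j" if "j < length bs" for j
    using the_inv_into_f_f[OF inj] that by auto
  have "(\<Sum>x\<in>set bs. scale (a (?ix x) - b (?ix x)) x) = 0"
    using assms(3) sum_list_coords[OF assms(1), of "\<lambda>x. a (?ix x) - b (?ix x)"]
    by (simp add: ix scale_left_diff_distrib sum_subtractf)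
  hence "a (?ix (bs ! i)) - b (?ix (bs ! i)) = 0"
    using assms(2,4) independentD[of "set bs" "set bs" "\<lambda>x. a (?ix x) - b (?ix x)" "bs ! i"] by auto
  thus ?thesis using ix assms(4) by simp
qed

lemma basis_list_coords:
  assumes "distinct bs" "x \<in> span (set bs)"
  shows "\<exists>c. x = (\<Sum>i<length bs. scale (c i) (bs ! i))"
proof -
  obtain u where "x = (\<Sum>v\<in>set bs. scale (u v) v)"
    using assms(2) by (auto simp: span_finite)
  thus ?thesis using sum_list_coords[OF assms(1), of u] by (intro exI[of _ "\<lambda>i. u (bs ! i)"]) simp
qed

lemma change_of_basis:
  assumes "distinct bs" "set cs \<subseteq> span (set bs)"
  shows "\<exists>P\<in>carrier_mat (length bs) (length cs).
           \<forall>j<length cs. cs ! j = (\<Sum>i<length bs. scale (P $$ (i, j)) (bs ! i))"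
proof -
  have "\<forall>j. \<exists>c. j < length cs \<longrightarrow> cs ! j = (\<Sum>i<length bs. scale (c i) (bs ! i))"
    using basis_list_coords[OF assms(1)] assms(2) nth_mem by blast
  then obtain c where c: "\<And>j. j < length cs \<Longrightarrow> cs ! j = (\<Sum>i<length bs. scale (c j i) (bs ! i))"
    by metis
  show ?thesis
    by (rule bexI[of _ "mat (length bs) (length cs) (\<lambda>(i, j). c j i)"]) (auto simp: c)
qed

lemma coords_mat_mult:
  assumes "P \<in> carrier_mat n m" "Q \<in> carrier_mat m l" "j < l"
    and "\<And>i. i < m \<Longrightarrow> y i = (\<Sum>h<n. scale (P $$ (h, i)) (x h))"
  shows "(\<Sum>i<m. scale (Q $$ (i, j)) (y i)) = (\<Sum>h<n. scale ((P * Q) $$ (h, j)) (x h))"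
proof -
  have "(\<Sum>i<m. scale (Q $$ (i, j)) (y i))
      = (\<Sum>i<m. \<Sum>h<n. scale (P $$ (h, i) * Q $$ (i, j)) (x h))"
    by (simp add: assms(4) scale_sum_right mult.commute)
  also have "\<dots> = (\<Sum>h<n. \<Sum>i<m. scale (P $$ (h, i) * Q $$ (i, j)) (x h))"
    by (rule sum.swap)
  also have "\<dots> = (\<Sum>h<n. scale ((P * Q) $$ (h, j)) (x h))"
    using assms(1-3)
    by (intro sum.cong) (auto simp: scalar_prod_def atLeast0LessThan simp flip: scale_sum_left)
  finally show ?thesis .
qed

lemma coords_mat_unique:
  assumes "distinct bs" "independent (set bs)"
    and "A \<in> carrier_mat (length bs) m" "B \<in> carrier_mat (length bs) m"
    and "\<And>j. j < m \<Longrightarrow> (\<Sum>i<length bs. scale (A $$ (i, j)) (bs ! i))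
                     = (\<Sum>i<length bs. scale (B $$ (i, j)) (bs ! i))"
  shows "A = B"
proof (rule eq_matI)
  fix i j assume "i < dim_row B" "j < dim_col B"
  hence ij: "i < length bs" "j < m" using assms(4) by auto
  show "A $$ (i, j) = B $$ (i, j)"
    by (rule basis_list_unique[OF assms(1,2) assms(5)[OF ij(2)] ij(1)])
qed (use assms(3,4) in auto)

lemma coords_one:
  assumes "j < length bs"
  shows "(\<Sum>i<length bs. scale (1\<^sub>m (length bs) $$ (i, j)) (bs ! i)) = bs ! j"
proof -
  have "(\<Sum>i<length bs. scale (1\<^sub>m (length bs) $$ (i, j)) (bs ! i))
      = (\<Sum>i<length bs. if i = j then bs ! i else 0)"
    using assms by (intro sum.cong) auto
  thus ?thesis using assms by simp
qed

lemma represents_similar: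
  assumes T: "Vector_Spaces.linear scale scale T"
    and bA: "represents scale W T bs A" and cB: "represents scale W T cs B"
  shows "similar_mat A B"
proof -
  interpret T: Vector_Spaces.linear scale scale T by (rule T)
  note b = bA[unfolded represents_def] and c = cB[unfolded represents_def]
  have "card (set bs) = card (set cs)"
    using b c by (metis dim_eq_card)
  hence len: "length cs = length bs" using b c by (simp add: distinct_card)
  define n where "n = length bs"
  have lb: "length bs = n" and lc: "length cs = n" by (simp_all add: n_def len)
  have A: "A \<in> carrier_mat n n" and B: "B \<in> carrier_mat n n" using b c lb lc by auto
  have cb: "set cs \<subseteq> span (set bs)" and bc: "set bs \<subseteq> span (set cs)"
    using b c span_superset by metis+
  obtain P where P: "P \<in> carrier_mat n n"
      "\<And>j. j < n \<Longrightarrow> cs ! j = (\<Sum>i<n. scale (P $$ (i, j)) (bs ! i))"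
    using change_of_basis[OF _ cb] b lb lc by auto
  obtain Q where Q: "Q \<in> carrier_mat n n"
      "\<And>j. j < n \<Longrightarrow> bs ! j = (\<Sum>i<n. scale (Q $$ (i, j)) (cs ! i))"
    using change_of_basis[OF _ bc] c lb lc by auto
  have TA: "T (bs ! j) = (\<Sum>i<n. scale (A $$ (i, j)) (bs ! i))" if "j < n" for j
    using b lb that by auto
  have TB: "T (cs ! j) = (\<Sum>i<n. scale (B $$ (i, j)) (cs ! i))" if "j < n" for j
    using c lc that by auto
  have PQ: "P * Q = 1\<^sub>m n"
  proof (rule coords_mat_unique[of bs _ n])
    fix j assume j: "j < n"
    show "(\<Sum>i<length bs. scale ((P * Q) $$ (i, j)) (bs ! i))
        = (\<Sum>i<length bs. scale (1\<^sub>m n $$ (i, j)) (bs ! i))"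
      using coords_mat_mult[OF P(1) Q(1) j P(2)] Q(2)[OF j] coords_one[of j bs] j lb by simp
  qed (use b P Q lb in auto)
  have QP: "Q * P = 1\<^sub>m n"
  proof (rule coords_mat_unique[of cs _ n])
    fix j assume j: "j < n"
    show "(\<Sum>i<length cs. scale ((Q * P) $$ (i, j)) (cs ! i))
        = (\<Sum>i<length cs. scale (1\<^sub>m n $$ (i, j)) (cs ! i))"
      using coords_mat_mult[OF Q(1) P(1) j Q(2)] P(2)[OF j] coords_one[of j cs] j lc by simp
  qed (use c P Q lc in auto)
  have "A * P = P * B"
  proof (rule coords_mat_unique[of bs _ n])
    fix j assume j: "j < n"
    have "(\<Sum>i<n. scale ((A * P) $$ (i, j)) (bs ! i)) = (\<Sum>i<n. scale (P $$ (i, j)) (T (bs ! i)))"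
      using coords_mat_mult[OF A P(1) j, of "\<lambda>i. T (bs ! i)" "(!) bs"] TA by simp
    also have "\<dots> = T (cs ! j)"
      using P(2)[OF j] by (simp add: T.sum T.scale)
    also have "\<dots> = (\<Sum>i<n. scale ((P * B) $$ (i, j)) (bs ! i))"
      using coords_mat_mult[OF P(1) B j P(2)] TB[OF j] by simp
    finally show "(\<Sum>i<length bs. scale ((A * P) $$ (i, j)) (bs ! i))
        = (\<Sum>i<length bs. scale ((P * B) $$ (i, j)) (bs ! i))" by (simp add: lb)
  qed (use b A B P lb in auto)
  hence "P * B * Q = A"
    using assoc_mult_mat[OF A P(1) Q(1)] PQ A by simp
  hence "similar_mat_wit A B P Q"
    using A B P Q PQ QP unfolding similar_mat_wit_def by (auto simp: Let_def)
  thus ?thesis unfolding similar_mat_def by blast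
qed

lemma endo_char_poly_eq:
  assumes "Vector_Spaces.linear scale scale T" "represents scale W T bs A"
  shows "endo_char_poly scale W T = char_poly A"
  unfolding endo_char_poly_def
proof (rule the_equality)
  show "\<exists>bs' A'. represents scale W T bs' A' \<and> char_poly A = char_poly A'"
    using assms(2) by blast
next
  fix p assume "\<exists>bs' A'. represents scale W T bs' A' \<and> p = char_poly A'"
  then obtain bs' A' where "represents scale W T bs' A'" "p = char_poly A'" by blast
  thus "p = char_poly A"
    using char_poly_similar[OF represents_similar[OF assms(1) _ assms(2)]] by simp
qed

lemma represents_exists:
  assumes "subspace W" "finite S" "W \<subseteq> span S" "T ` W \<subseteq> W"
  shows "\<exists>bs A. represents scale W T bs A"
proof -
  obtain B where B: "B \<subseteq> W" "independent B" "W \<subseteq> span B"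
    using maximal_independent_subset by metis
  have fB: "finite B" using B assms independent_span_bound[of S B] by auto
  have sB: "span B = W" using B assms(1) by (metis span_subspace)
  obtain bs where bs: "set bs = B" "distinct bs" using fB finite_distinct_list by blast
  have "set (map T bs) \<subseteq> span (set bs)" using bs B sB assms(4) by auto
  from change_of_basis[OF bs(2) this] obtain A where
    "A \<in> carrier_mat (length bs) (length bs)"
    "\<forall>j<length bs. T (bs ! j) = (\<Sum>i<length bs. scale (A $$ (i, j)) (bs ! i))" by auto
  thus ?thesis using bs B sB unfolding represents_def by blast
qed

end

lemma (in pair_graph) laplacian_char_poly_represents:
  "\<exists>bs A. represents rat_scale (rat_Div0 G) (rat_laplacian G) bs A
          \<and> laplacian_char_poly G = char_poly A"
proof -
  let ?S = "(\<lambda>v. Poly_Mapping.single v (1::rat)) ` pverts G"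
  have "D \<in> rat_vs.span ?S" if "D \<in> rat_Div0 G" for D
  proof -
    have "D = (\<Sum>v\<in>Poly_Mapping.keys D. rat_scale (Poly_Mapping.lookup D v) (Poly_Mapping.single v 1))"
      by (rule poly_mapping_eqI) (auto simp: lookup_sum_pm lookup_single when_def in_keys_iff
          if_distrib sum.delta cong: if_cong)
    also have "\<dots> \<in> rat_vs.span ?S"
      using that by (intro rat_vs.span_sum rat_vs.span_scale rat_vs.span_base)
        (auto simp: rat_Div0_def)
    finally show ?thesis .
  qed
  moreover have "rat_laplacian G ` rat_Div0 G \<subseteq> rat_Div0 G"
    using rat_laplacian_in_rat_Div0 by (auto simp: rat_Div0_def)
  ultimately obtain bs A where "represents rat_scale (rat_Div0 G) (rat_laplacian G) bs A"
    using rat_vs.represents_exists[OF subspace_rat_Div0, of ?S G] pair_finite_verts by blast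
  thus ?thesis
    using rat_vs.endo_char_poly_eq[OF linear_rat_laplacian] unfolding laplacian_char_poly_def by blast
qed

end

theory Submission
  imports Defs
begin

text \<open>
  Write \<open>L\<close> for the Laplacian of the cone, \<open>\<Delta>\<close> for that of \<open>\<Gamma>\<close> and \<open>w\<^sub>0, \<dots>, w\<^sub>n\<^sub>-\<^sub>1\<close> for the
  vertices of \<open>K\<^sub>n\<close>. On a degree 0 divisor supported on \<open>K\<^sub>n\<close>, \<open>L\<close> is multiplication by \<open>n + k\<close>, so
  the classes of \<open>w\<^sub>i - w\<^sub>0\<close> give a map from \<open>(\<int>/(n + k))\<^sup>n\<^sup>-\<^sup>1\<close>. If \<open>L E\<close> is supported on \<open>K\<^sub>n\<close>, then
  \<open>(\<Delta> + n) E\<close> is constant on \<open>\<Gamma>\<close>, so \<open>E\<close> is constant on \<open>\<Gamma>\<close> by the maximum principle, and the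
  coefficients of \<open>L E\<close> are divisible by \<open>n + k\<close>: the map is injective.

  Restriction to \<open>\<Gamma>\<close> identifies the cokernel with \<open>\<int>\<^sup>V / (\<int>\<one> + (\<Delta> + n) \<int>\<^sup>V)\<close>, that is, with the
  cokernel of the matrix of \<open>\<Delta> + n\<close> on \<open>\<int>\<^sup>V / \<int>\<one>\<close> in the basis \<open>v\<^sub>1, \<dots>, v\<^sub>k\<^sub>-\<^sub>1\<close>. As \<open>\<Delta>\<close> is symmetric,
  this is the transpose of the matrix of \<open>\<Delta> + n\<close> on \<open>Div\<^sup>0\<close> in the basis \<open>v\<^sub>j - v\<^sub>0\<close>, whose
  determinant is \<open>\<plusminus>P(-n)\<close>. It is non-zero, again by the maximum principle, and the cokernel of a
  non-singular integer matrix \<open>A\<close> has order \<open>\<bar>det A\<bar>\<close>.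
\<close>

section \<open>The index of the column lattice of an integer matrix\<close>

definition column_lattice :: "int mat \<Rightarrow> int vec set" where
  "column_lattice A = (*\<^sub>v) A ` carrier_vec (dim_col A)"

text \<open>A set of coset representatives: for a lattice \<open>L\<close>, the cardinality of
  \<open>T\<close> is the index of \<open>L\<close> in the integer vectors of dimension
  \<open>m\<close>. Representatives can be built coordinate by coordinate and later lifted to
  divisors, without forming a quotient of vectors.\<close>

definition transversal :: "nat \<Rightarrow> int vec set \<Rightarrow> int vec set \<Rightarrow> bool" where
  "transversal m L T \<longleftrightarrow> finite T \<and> T \<subseteq> carrier_vec m
     \<and> (\<forall>x\<in>carrier_vec m. \<exists>!t. t \<in> T \<and> x - t \<in> L)"

text \<open>Since \<open>A = (A * U) * V\<close>, the columns of \<open>A\<close> and of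
  \<open>A * U\<close> are integer combinations of each other. This covers the elementary column
  operations, whose matrices are invertible over the integers.\<close>

lemma column_lattice_mult_inverse:
  assumes A: "A \<in> carrier_mat n m" and U: "U \<in> carrier_mat m m" and V: "V \<in> carrier_mat m m"
    and UV: "U * V = 1\<^sub>m m"
  shows "column_lattice (A * U) = column_lattice A"
proof
  show "column_lattice (A * U) \<subseteq> column_lattice A"
  proof
    fix x assume "x \<in> column_lattice (A * U)"
    then obtain v where v: "v \<in> carrier_vec m" "x = (A * U) *\<^sub>v v"
      using U by (auto simp: column_lattice_def)
    have "x = A *\<^sub>v (U *\<^sub>v v)" using v A U by simp
    moreover have "U *\<^sub>v v \<in> carrier_vec (dim_col A)" using A U v by simp
    ultimately show "x \<in> column_lattice A" unfolding column_lattice_def by blast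
  qed
  show "column_lattice A \<subseteq> column_lattice (A * U)"
  proof
    fix x assume "x \<in> column_lattice A"
    then obtain v where v: "v \<in> carrier_vec m" "x = A *\<^sub>v v"
      using A by (auto simp: column_lattice_def)
    have "A * U * V = A" using A U V UV by (simp add: assoc_mult_mat[OF A U V])
    hence "x = (A * U) *\<^sub>v (V *\<^sub>v v)"
      using v A U V by (metis assoc_mult_mat_vec mult_carrier_mat)
    moreover have "V *\<^sub>v v \<in> carrier_vec (dim_col (A * U))" using U V v by simp
    ultimately show "x \<in> column_lattice (A * U)" unfolding column_lattice_def by blast
  qed
qed

lemma mult_mat_vec_vCons:
  fixes B :: "int mat"
  assumes B: "B \<in> carrier_mat (Suc m) (Suc m)" and w: "w \<in> carrier_vec m"
    and row: "\<And>j. 0 < j \<Longrightarrow> j < Suc m \<Longrightarrow> B $$ (0, j) = 0"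
  shows "B *\<^sub>v vCons a w = vCons (B $$ (0, 0) * a)
           (vec m (\<lambda>i. B $$ (Suc i, 0) * a) + mat m m (\<lambda>(i, j). B $$ (Suc i, Suc j)) *\<^sub>v w)"
    (is "_ = ?R")
proof (rule eq_vecI)
  show "dim_vec (B *\<^sub>v vCons a w) = dim_vec ?R" using B by simp
  fix i assume "i < dim_vec ?R"
  hence i: "i < Suc m" by simp
  have "(B *\<^sub>v vCons a w) $ i = (\<Sum>j\<in>{0..<Suc m}. B $$ (i, j) * vCons a w $ j)"
    using B w i by (simp add: scalar_prod_def)
  also have "\<dots> = B $$ (i, 0) * a + (\<Sum>j\<in>{0..<m}. B $$ (i, Suc j) * w $ j)"
    by (subst sum.atLeast0_lessThan_Suc_shift) (auto intro!: sum.cong)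
  also have "\<dots> = ?R $ i"
    using i w row by (cases i) (auto simp: scalar_prod_def)
  finally show "(B *\<^sub>v vCons a w) $ i = ?R $ i" .
qed

lemma det_block_triangular_row:
  fixes B :: "int mat"
  assumes B: "B \<in> carrier_mat (Suc m) (Suc m)"
    and row: "\<And>j. 0 < j \<Longrightarrow> j < Suc m \<Longrightarrow> B $$ (0, j) = 0"
  shows "det B = B $$ (0, 0) * det (mat m m (\<lambda>(i, j). B $$ (Suc i, Suc j)))"
proof -
  have "det B = (\<Sum>j<Suc m. B $$ (0, j) * cofactor B 0 j)"
    by (rule laplace_expansion_row[OF B]) simp
  also have "\<dots> = B $$ (0, 0) * cofactor B 0 0"
    by (subst sum.lessThan_Suc_shift) (auto simp: row)
  also have "cofactor B 0 0 = det (mat_delete B 0 0)" by (simp add: cofactor_def)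
  also have "mat_delete B 0 0 = mat m m (\<lambda>(i, j). B $$ (Suc i, Suc j))"
    using B by (intro eq_matI) (auto simp: mat_delete_def)
  finally show ?thesis .
qed

text \<open>The first coordinate of a lattice vector is a multiple \<open>d * a\<close> of the
  corner entry \<open>d\<close>. So the first coordinate of \<open>x\<close> fixes a residue modulo
  \<open>\<bar>d\<bar>\<close>, the residue fixes \<open>a\<close> because \<open>d\<close> is
  non-zero, and subtracting \<open>a\<close> times the first column leaves a problem for the lower
  right block.\<close>

lemma transversal_vCons:
  fixes B :: "int mat" and m :: nat
  defines "A \<equiv> mat m m (\<lambda>(i, j). B $$ (Suc i, Suc j))"
  assumes B: "B \<in> carrier_mat (Suc m) (Suc m)"
    and row: "\<And>j. 0 < j \<Longrightarrow> j < Suc m \<Longrightarrow> B $$ (0, j) = 0"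
    and d: "B $$ (0, 0) \<noteq> 0" and T: "transversal m (column_lattice A) T"
  shows "transversal (Suc m) (column_lattice B)
           ((\<lambda>(i, t). vCons i t) ` ({0..<\<bar>B $$ (0, 0)\<bar>} \<times> T))" (is "transversal _ _ ?S")
  unfolding transversal_def
proof (intro conjI ballI)
  have Tf: "finite T" and Tc: "\<And>t. t \<in> T \<Longrightarrow> t \<in> carrier_vec m"
    and Tu: "\<And>x. x \<in> carrier_vec m \<Longrightarrow> \<exists>!t. t \<in> T \<and> x - t \<in> column_lattice A"
    using T by (auto simp: transversal_def)
  have A: "A \<in> carrier_mat m m" by (simp add: A_def)
  let ?d = "B $$ (0, 0)"
  let ?c = "\<lambda>a. vec m (\<lambda>i. B $$ (Suc i, 0) * a)"
  show "finite ?S" using Tf by simp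
  show "?S \<subseteq> carrier_vec (Suc m)" using Tc by auto
  fix x :: "int vec" assume x: "x \<in> carrier_vec (Suc m)"
  define x0 where "x0 = x $ 0"
  define y where "y = vec m (\<lambda>i. x $ Suc i)"
  have y: "y \<in> carrier_vec m" by (simp add: y_def)
  have xy: "x = vCons x0 y"
    using x by (intro eq_vecI) (auto simp: x0_def y_def vec_index_vCons split: if_splits)
  \<comment> \<open>The scalar \<open>a\<close> is the first coordinate of a preimage under
    \<open>B\<close>, and \<open>?c a\<close> is the part of \<open>a\<close> times the first column
    that lies below the corner.\<close>
  have key: "x - vCons i t \<in> column_lattice B \<longleftrightarrow>
      (\<exists>a. x0 - i = ?d * a \<and> (y - ?c a) - t \<in> column_lattice A)"
    if t: "t \<in> carrier_vec m" for i t
  proof -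
    have diff: "x - vCons i t = vCons (x0 - i) (y - t)"
      using y t by (intro eq_vecI) (auto simp: xy vec_index_vCons)
    have "x - vCons i t \<in> column_lattice B \<longleftrightarrow> (\<exists>a. \<exists>w\<in>carrier_vec m. x - vCons i t = B *\<^sub>v vCons a w)"
    proof
      assume "x - vCons i t \<in> column_lattice B"
      then obtain v where v: "v \<in> carrier_vec (Suc m)" "x - vCons i t = B *\<^sub>v v"
        using B by (auto simp: column_lattice_def)
      thus "\<exists>a. \<exists>w\<in>carrier_vec m. x - vCons i t = B *\<^sub>v vCons a w" 
        by (cases v) auto
    qed (use B in \<open>auto simp: column_lattice_def\<close>)
    also have "\<dots> \<longleftrightarrow> (\<exists>a. \<exists>w\<in>carrier_vec m. x0 - i = ?d * a \<and> y - t = ?c a + A *\<^sub>v w)"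
      unfolding diff by (intro ex_cong1 bex_cong refl, subst mult_mat_vec_vCons[OF B _ row]) (auto simp: A_def)
    also have "\<dots> \<longleftrightarrow> (\<exists>a. \<exists>w\<in>carrier_vec m. x0 - i = ?d * a \<and> (y - ?c a) - t = A *\<^sub>v w)"
    proof (intro ex_cong1 bex_cong refl conj_cong)
      fix a and w :: "int vec" assume w: "w \<in> carrier_vec m"
      hence "A *\<^sub>v w \<in> carrier_vec m" using A by simp
      thus "(y - t = ?c a + A *\<^sub>v w) = (y - ?c a - t = A *\<^sub>v w)"
        using y t by (auto simp: vec_eq_iff algebra_simps)
    qed
    also have "\<dots> \<longleftrightarrow> (\<exists>a. x0 - i = ?d * a \<and> (y - ?c a) - t \<in> column_lattice A)"
      using A by (auto simp: column_lattice_def)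
    finally show ?thesis .
  qed
  define i0 where "i0 = x0 mod \<bar>?d\<bar>"
  have i0: "0 \<le> i0" "i0 < \<bar>?d\<bar>" using d by (auto simp: i0_def)
  have "?d dvd x0 - i0" by (metis abs_dvd_iff i0_def minus_mod_eq_mult_div dvd_triv_left)
  then obtain a0 where a0: "x0 - i0 = ?d * a0" by blast
  obtain t0 where t0: "t0 \<in> T" "(y - ?c a0) - t0 \<in> column_lattice A"
    and t0u: "\<And>t. t \<in> T \<Longrightarrow> (y - ?c a0) - t \<in> column_lattice A \<Longrightarrow> t = t0"
    using Tu[of "y - ?c a0"] y by fastforce
  show "\<exists>!s. s \<in> ?S \<and> x - s \<in> column_lattice B"
  proof (intro ex1I[of _ "vCons i0 t0"] conjI)
    show "vCons i0 t0 \<in> ?S" using i0 t0 by auto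
    show "x - vCons i0 t0 \<in> column_lattice B" using key[OF Tc[OF t0(1)]] a0 t0 by blast
    fix s assume "s \<in> ?S \<and> x - s \<in> column_lattice B"
    then obtain i t where s: "s = vCons i t" "0 \<le> i" "i < \<bar>?d\<bar>" "t \<in> T"
      and L: "x - vCons i t \<in> column_lattice B" by auto
    then obtain a where a: "x0 - i = ?d * a" "(y - ?c a) - t \<in> column_lattice A"
      using key[OF Tc[OF s(4)]] by blast
    have "\<bar>?d\<bar> dvd x0 - i" using a by simp
    hence "i mod \<bar>?d\<bar> = x0 mod \<bar>?d\<bar>" by (metis mod_eq_dvd_iff)
    hence i: "i = i0" using s by (simp add: i0_def)
    hence "a = a0" using a a0 d by simp
    thus "s = vCons i0 t0" using i a s t0u by auto
  qed
qed

text \<open>Column operations keep the lattice and the absolute value of the determinant. The outer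
  induction is on the dimension. The inner one runs the Euclidean algorithm on the first row, with
  the sum of absolute values as measure, until at most one entry is left to be moved to the corner
  and split off.\<close>

lemma exists_transversal_det:
  assumes "A \<in> carrier_mat m m" "det A \<noteq> 0"
  shows "\<exists>T. transversal m (column_lattice A) T \<and> int (card T) = \<bar>det A\<bar>"
  using assms
proof (induction m arbitrary: A)
  case 0
  have "x - 0\<^sub>v 0 \<in> column_lattice A" if "x \<in> carrier_vec 0" for x
  proof -
    have "x - 0\<^sub>v 0 = A *\<^sub>v 0\<^sub>v 0" using 0 that by (intro eq_vecI) auto
    thus ?thesis using 0 unfolding column_lattice_def by (intro image_eqI[of _ _ "0\<^sub>v 0"]) auto
  qed
  hence "transversal 0 (column_lattice A) {0\<^sub>v 0}"
    unfolding transversal_def by auto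
  thus ?case using 0 by (intro exI[of _ "{0\<^sub>v 0}"]) auto
next
  case (Suc m)
  show ?case using Suc.prems
  proof (induction "\<Sum>j<Suc m. nat \<bar>A $$ (0, j)\<bar>" arbitrary: A rule: less_induct)
    case less
    note A = less.prems(1)
    show ?case
    proof (cases "\<exists>j l. j < Suc m \<and> l < Suc m \<and> j \<noteq> l \<and> A $$ (0, j) \<noteq> 0 \<and> A $$ (0, l) \<noteq> 0")
      case True
      then obtain p q where pq: "p < Suc m" "q < Suc m" "p \<noteq> q"
        "A $$ (0, p) \<noteq> 0" "A $$ (0, q) \<noteq> 0" by blast
      obtain j l where jl: "j < Suc m" "l < Suc m" "j \<noteq> l"
        and nz: "A $$ (0, l) \<noteq> 0" and le: "\<bar>A $$ (0, l)\<bar> \<le> \<bar>A $$ (0, j)\<bar>"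
      proof (cases "\<bar>A $$ (0, q)\<bar> \<le> \<bar>A $$ (0, p)\<bar>")
        case True
        show ?thesis by (rule that[OF pq(1,2,3,5) True])
      next
        case False
        hence "\<bar>A $$ (0, p)\<bar> \<le> \<bar>A $$ (0, q)\<bar>" by linarith
        thus ?thesis by (rule that[OF pq(2,1) pq(3)[symmetric] pq(4)])
      qed
      \<comment> \<open>\<open>addcol c j l\<close> adds \<open>c\<close> times column
        \<open>l\<close> to column \<open>j\<close>, so this choice replaces the larger entry
        \<open>A $$ (0, j)\<close> by its remainder modulo \<open>A $$ (0, l)\<close>.\<close>
      define c where "c = - (A $$ (0, j) div A $$ (0, l))"
      define B where "B = addcol c j l A"
      have B: "B \<in> carrier_mat (Suc m) (Suc m)" unfolding B_def using A by (intro carrier_matI) auto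
      have B0: "B $$ (0, i) = (if i = j then A $$ (0, j) mod A $$ (0, l) else A $$ (0, i))"
        if "i < Suc m" for i
        using A that by (auto simp: B_def c_def minus_div_mult_eq_mod algebra_simps)
      have "(\<Sum>i<Suc m. nat \<bar>B $$ (0, i)\<bar>) < (\<Sum>i<Suc m. nat \<bar>A $$ (0, i)\<bar>)"
      proof (rule sum_strict_mono_ex1)
        have "\<bar>A $$ (0, j) mod A $$ (0, l)\<bar> < \<bar>A $$ (0, j)\<bar>"
          using abs_mod_less[OF nz, of "A $$ (0, j)"] le by linarith
        thus "\<forall>i\<in>{..<Suc m}. nat \<bar>B $$ (0, i)\<bar> \<le> nat \<bar>A $$ (0, i)\<bar>"
          and "\<exists>i\<in>{..<Suc m}. nat \<bar>B $$ (0, i)\<bar> < nat \<bar>A $$ (0, i)\<bar>"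
          using jl by (auto simp: B0 intro!: bexI[of _ j])
      qed simp
      moreover have detB: "det B = det A" using det_addcol[OF jl(2,3) A] by (simp add: B_def)
      moreover have "column_lattice B = column_lattice A"
        unfolding B_def addcol_mat[OF A jl(2)]
        by (rule column_lattice_mult_inverse[OF A _ _ addrow_mat_inv]) (use jl in auto)
      ultimately show ?thesis using less.hyps[OF _ B] less.prems(2) by simp
    next
      case False
      \<comment> \<open>No two entries of the first row are non-zero; if the row vanishes
        altogether, any column serves as \<open>j\<close>.\<close>
      then obtain j where j: "j < Suc m" "\<And>i. i < Suc m \<Longrightarrow> i \<noteq> j \<Longrightarrow> A $$ (0, i) = 0"
        by (metis zero_less_Suc)
      define B where "B = swapcols 0 j A"
      have B: "B \<in> carrier_mat (Suc m) (Suc m)" using A by (simp add: B_def)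
      have row: "B $$ (0, i) = 0" if "0 < i" "i < Suc m" for i
        using A that j by (auto simp: B_def)
      have detB: "\<bar>det B\<bar> = \<bar>det A\<bar>"
      proof (cases "j = 0")
        case True
        hence "B = A" using A by (intro eq_matI) (auto simp: B_def)
        thus ?thesis by simp
      qed (use det_swapcols[OF _ j(1) _ A, of 0] in \<open>simp add: B_def\<close>)
      have lat: "column_lattice B = column_lattice A"
        unfolding B_def swapcols_mat[OF A zero_less_Suc j(1)]
        by (rule column_lattice_mult_inverse[OF A _ _ swaprows_mat_inv]) (use j in auto)
      let ?A = "mat m m (\<lambda>(i, j). B $$ (Suc i, Suc j))"
      have det: "det B = B $$ (0, 0) * det ?A" by (rule det_block_triangular_row[OF B row])
      hence nz: "B $$ (0, 0) \<noteq> 0" "det ?A \<noteq> 0" using detB less.prems(2) by auto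
      obtain T where T: "transversal m (column_lattice ?A) T" "int (card T) = \<bar>det ?A\<bar>"
        using Suc.IH[of ?A] nz by auto
      let ?S = "(\<lambda>(i, t). vCons i t) ` ({0..<\<bar>B $$ (0, 0)\<bar>} \<times> T)"
      have "transversal (Suc m) (column_lattice B) ?S"
        by (rule transversal_vCons[OF B row nz(1) T(1)])
      moreover have "int (card ?S) = \<bar>det B\<bar>"
        using T(2) by (subst card_image) (auto simp: inj_on_def card_cartesian_product det abs_mult)
      ultimately show ?thesis unfolding lat detB by blast
    qed
  qed
qed

section \<open>Laplacians as difference operators\<close>

lemma (in pair_graph) finite_in_neighbours [simp]: "finite {v. (v, u) \<in> parcs G}"
  by (rule finite_subset[OF _ pair_finite_verts]) (auto dest: in_arcsD1)

lemma (in pair_graph) parcs_commute: "(u, v) \<in> parcs G \<longleftrightarrow> (v, u) \<in> parcs G"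
  using pair_sym_arcs by (auto simp: symmetric_def sym_def)

text \<open>The degree of \<open>u\<close> counts the terms with
  \<open>Poly_Mapping.lookup D u\<close>, and a vertex \<open>v\<close> of the support sends
  \<open>- Poly_Mapping.lookup D v\<close> to \<open>u\<close> exactly when the two are adjacent.
  Written as a sum of differences, the Laplacian visibly kills constants.\<close>

lemma (in pair_graph) lookup_laplacian:
  "Poly_Mapping.lookup (laplacian G D) u
     = (\<Sum>v | (v, u) \<in> parcs G. Poly_Mapping.lookup D u - Poly_Mapping.lookup D v)"
proof -
  let ?K = "Poly_Mapping.keys D" and ?N = "{v. (v, u) \<in> parcs G}"
  have inner: "(\<Sum>w | (w, v) \<in> parcs G. Poly_Mapping.lookup (frag_of w) u)
      = (if (v, u) \<in> parcs G then 1 else (0::int))" for v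
  proof -
    have "(\<Sum>w | (w, v) \<in> parcs G. Poly_Mapping.lookup (frag_of w) u)
        = (\<Sum>w | (w, v) \<in> parcs G. if w = u then 1 else (0::int))"
      by (intro sum.cong) (auto simp: lookup_single when_def)
    thus ?thesis using parcs_commute[of u v] by simp
  qed
  have "Poly_Mapping.lookup (laplacian G D) u =
      (\<Sum>v\<in>?K. Poly_Mapping.lookup D v *
        (int (out_degree (with_proj G) v) * Poly_Mapping.lookup (frag_of v) u
          - (if (v, u) \<in> parcs G then 1 else 0)))"
    unfolding laplacian_def frag_extend_def 
    by (simp add: lookup_sum_pm lookup_minus inner del: lookup_frag_of)
  also have "\<dots> = (\<Sum>v\<in>?K. if v = u then Poly_Mapping.lookup D u * int (card ?N) else 0)
      - (\<Sum>v\<in>?K. if v \<in> ?N then Poly_Mapping.lookup D v else 0)"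
    unfolding sum_subtractf[symmetric]
    by (intro sum.cong) (auto simp: out_degree_eq_card lookup_single when_def algebra_simps)
  also have "(\<Sum>v\<in>?K. if v = u then Poly_Mapping.lookup D u * int (card ?N) else 0)
      = Poly_Mapping.lookup D u * int (card ?N)"
    by (auto simp: in_keys_iff)
  also have "(\<Sum>v\<in>?K. if v \<in> ?N then Poly_Mapping.lookup D v else 0)
      = (\<Sum>v\<in>?N. Poly_Mapping.lookup D v)"
    by (subst sum.inter_restrict[symmetric]) (auto intro!: sum.mono_neutral_left simp: in_keys_iff)
  finally show ?thesis by (simp add: sum_subtractf mult.commute)
qed

lemma pair_graph_join:
  assumes "pair_graph G" "pair_graph H"
  shows "pair_graph (graph_join G H)"
proof -
  interpret G: pair_graph G by fact
  interpret H: pair_graph H by fact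
  show ?thesis
  proof
    fix e assume "e \<in> parcs (graph_join G H)"
    thus "fst e \<in> pverts (graph_join G H)" "snd e \<in> pverts (graph_join G H)" "fst e \<noteq> snd e"
      by (auto simp: graph_join_def dest: G.in_arcsD1 G.in_arcsD2 H.in_arcsD1 H.in_arcsD2
          G.pair_no_loops H.pair_no_loops)
  next
    show "symmetric (with_proj (graph_join G H))"
      using G.parcs_commute H.parcs_commute
      by (auto simp: symmetric_def sym_def graph_join_def)
  qed (auto simp: graph_join_def G.pair_finite_verts H.pair_finite_verts
        G.pair_finite_arcs H.pair_finite_arcs)
qed

lemma complete_pair_digraph:
  assumes "complete_digraph n (with_proj K)"
  shows "pair_graph K" "finite (pverts K)" "card (pverts K) = n"
    "(u, v) \<in> parcs K \<longleftrightarrow> u \<in> pverts K \<and> v \<in> pverts K \<and> u \<noteq> v"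
proof -
  have "graph (with_proj K)" "card (verts (with_proj K)) = n"
    and ends: "arcs_ends (with_proj K) = {(u, v). (u, v) \<in> verts (with_proj K) \<times> verts (with_proj K) \<and> u \<noteq> v}"
    using assms by (auto simp: complete_digraph_def)
  then interpret graph "with_proj K" by simp
  show "card (pverts K) = n" using \<open>card (verts (with_proj K)) = n\<close> by simp
  show fin: "finite (pverts K)" using finite_verts by simp
  have arcs: "parcs K = {(u, v). (u, v) \<in> pverts K \<times> pverts K \<and> u \<noteq> v}"
    using ends by simp
  show "(u, v) \<in> parcs K \<longleftrightarrow> u \<in> pverts K \<and> v \<in> pverts K \<and> u \<noteq> v" by (simp add: arcs)
  show "pair_graph K"
    by unfold_locales (use fin finite_arcs sym_arcs in \<open>auto simp: arcs symmetric_def sym_def\<close>)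
qed

text \<open>The Laplacian on arbitrary integer functions, so that restrictions, constants and
  indicators can be inserted without first being made into divisors.\<close>

definition vertex_laplacian :: "'a pair_pre_digraph \<Rightarrow> ('a \<Rightarrow> int) \<Rightarrow> 'a \<Rightarrow> int" where
  "vertex_laplacian G e u = (\<Sum>v | (v, u) \<in> parcs G. e u - e v)"

context pair_graph
begin

text \<open>Discrete maximum principle: at a maximum of \<open>e\<close> the Laplacian is non-negative, at a minimum
  non-positive.\<close>

lemma shifted_laplacian_const_imp_const:
  assumes "n > 0" "\<And>u. u \<in> pverts G \<Longrightarrow> vertex_laplacian G e u + n * e u = s"
    and "x \<in> pverts G" "y \<in> pverts G"
  shows "e x = e y"
proof -
  have fin: "finite (e ` pverts G)" and ne: "e ` pverts G \<noteq> {}"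
    using pair_finite_verts assms(3) by auto
  obtain p q where p: "p \<in> pverts G" "e p = Max (e ` pverts G)"
    and q: "q \<in> pverts G" "e q = Min (e ` pverts G)"
    using Max_in[OF fin ne] Min_in[OF fin ne] by (metis imageE)
  have "vertex_laplacian G e p \<ge> 0"
    unfolding vertex_laplacian_def using p fin by (intro sum_nonneg) (auto dest: in_arcsD1)
  moreover have "vertex_laplacian G e q \<le> 0"
    unfolding vertex_laplacian_def using q fin by (intro sum_nonpos) (auto dest: in_arcsD1)
  \<comment> \<open>Both \<open>p\<close> and \<open>q\<close> satisfy the equation with the same
    right-hand side \<open>s\<close>, so the signs of the two Laplacians compare the shift
    terms.\<close>
  ultimately have "n * e p \<le> n * e q"
    using assms(2)[OF p(1)] assms(2)[OF q(1)] by linarith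
  hence "e p \<le> e q" using assms(1) by simp
  moreover have "e q \<le> e x" "e q \<le> e y" "e x \<le> e p" "e y \<le> e p"
    using p q fin assms(3,4) by auto
  ultimately show ?thesis by linarith
qed

text \<open>Off the diagonal both sides are \<open>-1\<close> or \<open>0\<close> according to
  adjacency. This symmetry makes the matrix modulo constants the transpose of the matrix on divisors
  of degree 0.\<close>

lemma vertex_laplacian_symmetric:
  "vertex_laplacian G (\<lambda>v. of_bool (v = x)) u = vertex_laplacian G (\<lambda>v. of_bool (v = u)) x"
proof (cases "x = u")
  case False
  have *: "vertex_laplacian G (\<lambda>v. of_bool (v = x)) u = - of_bool ((x, u) \<in> parcs G)"
    if "x \<noteq> u" for x u
  proof -
    have "vertex_laplacian G (\<lambda>v. of_bool (v = x)) u
        = - (\<Sum>v | (v, u) \<in> parcs G. if v = x then 1 else 0)"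
      using that unfolding vertex_laplacian_def sum_negf[symmetric] by (intro sum.cong) auto
    thus ?thesis by simp
  qed
  show ?thesis using *[OF False] *[OF False[symmetric]] parcs_commute[of x u] by simp
qed simp

text \<open>Constants are killed, so \<open>e\<close> may be replaced by \<open>e - e v0\<close>,
  which vanishes at \<open>v0\<close> and is a combination of the indicators of the other
  vertices.\<close>

lemma vertex_laplacian_expand:
  assumes "v0 \<in> pverts G"
  shows "vertex_laplacian G e u
    = (\<Sum>x\<in>pverts G - {v0}. (e x - e v0) * vertex_laplacian G (\<lambda>v. of_bool (v = x)) u)"
proof (cases "u \<in> pverts G")
  case True
  have delta: "(\<Sum>x\<in>pverts G. (e x - e v0) * of_bool (v = x)) = e v - e v0" if "v \<in> pverts G" for v
    using that pair_finite_verts by (simp add: of_bool_def if_distrib cong: if_cong)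
  have "(\<Sum>x\<in>pverts G - {v0}. (e x - e v0) * vertex_laplacian G (\<lambda>v. of_bool (v = x)) u)
      = (\<Sum>x\<in>pverts G. (e x - e v0) * vertex_laplacian G (\<lambda>v. of_bool (v = x)) u)"
    using assms pair_finite_verts by (intro sum.mono_neutral_left) auto
  also have "\<dots> = (\<Sum>v | (v, u) \<in> parcs G. \<Sum>x\<in>pverts G. (e x - e v0) * (of_bool (u = x) - of_bool (v = x)))"
    unfolding vertex_laplacian_def sum_distrib_left by (rule sum.swap)
  also have "\<dots> = vertex_laplacian G e u"
    unfolding vertex_laplacian_def
  proof (intro sum.cong refl)
    fix v assume "v \<in> {v. (v, u) \<in> parcs G}"
    hence "v \<in> pverts G" by (auto dest: in_arcsD1)
    thus "(\<Sum>x\<in>pverts G. (e x - e v0) * (of_bool (u = x) - of_bool (v = x))) = e u - e v"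
      using delta[OF True] delta[of v] by (simp add: right_diff_distrib sum_subtractf)
  qed
  finally show ?thesis by simp
next
  case False
  hence "{v. (v, u) \<in> parcs G} = {}" by (auto dest: in_arcsD2)
  thus ?thesis by (simp add: vertex_laplacian_def)
qed

end

section \<open>The Laplacian modulo constants\<close>

text \<open>The graph has \<open>Suc m\<close> vertices; \<open>v 0\<close> is the base vertex, and
  the other \<open>m\<close> index coordinates, with coordinate \<open>i\<close> belonging to
  \<open>v (Suc i)\<close>.\<close>

locale enumerated_graph = pair_graph G for G :: "'a pair_pre_digraph" +
  fixes v :: "nat \<Rightarrow> 'a" and m :: nat
  assumes enum: "bij_betw v {..m} (pverts G)"
begin

lemma v_in [simp]: "i \<le> m \<Longrightarrow> v i \<in> pverts G"
  using enum by (auto simp: bij_betw_def)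

lemma v_eq_iff [simp]: "i \<le> m \<Longrightarrow> j \<le> m \<Longrightarrow> v i = v j \<longleftrightarrow> i = j"
  using enum by (auto simp: bij_betw_def inj_on_eq_iff)

lemma v_cases:
  assumes "u \<in> pverts G"
  obtains i where "i \<le> m" "u = v i"
  using assms enum by (auto simp: bij_betw_def)

lemma bij_betw_v_Suc: "bij_betw (\<lambda>j. v (Suc j)) {..<m} (pverts G - {v 0})"
  unfolding bij_betw_def
proof
  show "inj_on (\<lambda>j. v (Suc j)) {..<m}" by (auto simp: inj_on_def)
  show "(\<lambda>j. v (Suc j)) ` {..<m} = pverts G - {v 0}"
  proof (intro equalityI subsetI)
    fix u assume u: "u \<in> pverts G - {v 0}"
    then obtain i where i: "i \<le> m" "u = v i" using v_cases by blast
    with u have "i \<noteq> 0" by auto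
    with i have "u = v (Suc (i - 1))" "i - 1 < m" by auto
    thus "u \<in> (\<lambda>j. v (Suc j)) ` {..<m}" by blast
  qed auto
qed

text \<open>The class of \<open>e\<close> modulo constants: there the class of \<open>v 0\<close> is
  minus the sum of the other vertex classes, which makes these differences the coordinates with
  respect to the classes of \<open>v 1, ..., v m\<close>.\<close>

definition reduced :: "('a \<Rightarrow> int) \<Rightarrow> int vec" where
  "reduced e = vec m (\<lambda>i. e (v (Suc i)) - e (v 0))"

lemma reduced_carrier [simp]: "reduced e \<in> carrier_vec m"
  by (simp add: reduced_def)

lemma reduced_eq_0_iff: "reduced e = 0\<^sub>v m \<longleftrightarrow> (\<forall>u\<in>pverts G. e u = e (v 0))"
proof
  assume L: "reduced e = 0\<^sub>v m"
  show "\<forall>u\<in>pverts G. e u = e (v 0)"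
  proof
    fix u assume "u \<in> pverts G"
    then obtain i where i: "i \<le> m" "u = v i" by (rule v_cases)
    show "e u = e (v 0)"
    proof (cases i)
      case (Suc j)
      have "reduced e $ j = 0\<^sub>v m $ j" by (simp add: L)
      thus ?thesis using i Suc by (simp add: reduced_def)
    qed (use i in simp)
  qed
next
  assume R: "\<forall>u\<in>pverts G. e u = e (v 0)"
  have "e (v (Suc i)) = e (v 0)" if "i < m" for i by (rule bspec[OF R]) (use that in simp)
  thus "reduced e = 0\<^sub>v m" by (intro eq_vecI) (simp_all add: reduced_def)
qed

lemma reduced_diff: "reduced (\<lambda>u. e u - e' u) = reduced e - reduced e'"
  by (intro eq_vecI) (auto simp: reduced_def)

lemma reduced_surj:
  assumes "x \<in> carrier_vec m"
  obtains e where "reduced e = x"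
proof
  let ?ix = "the_inv_into {..m} v"
  have ix: "?ix (v i) = i" if "i \<le> m" for i
    using enum that by (intro the_inv_into_f_f) (auto simp: bij_betw_def)
  \<comment> \<open>The lift is normalised to vanish at \<open>v 0\<close>; the index drops by one
    because coordinates start at \<open>v 1\<close>.\<close>
  show "reduced (\<lambda>u. if u = v 0 then 0 else x $ (?ix u - 1)) = x"
    using assms by (intro eq_vecI) (auto simp: reduced_def ix)
qed

definition vertex_delta :: "nat \<Rightarrow> 'a \<Rightarrow> int" where
  "vertex_delta j = (\<lambda>u. of_bool (u = v j))"

text \<open>The matrix of \<open>\<Delta> + c\<close> on \<open>Div G\<close> modulo the constant divisors, in the basis of the classes
  of \<open>v 1, \<dots>, v m\<close>.\<close>

definition shifted_reduced_laplacian :: "int \<Rightarrow> int mat" where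
  "shifted_reduced_laplacian c = mat m m (\<lambda>(i, j). c * of_bool (i = j)
     + vertex_laplacian G (vertex_delta (Suc j)) (v (Suc i))
     - vertex_laplacian G (vertex_delta (Suc j)) (v 0))"

lemma shifted_reduced_laplacian_carrier [simp]:
  "shifted_reduced_laplacian c \<in> carrier_mat m m"
  by (simp add: shifted_reduced_laplacian_def)

text \<open>By \<open>vertex_laplacian_expand\<close>, the Laplacian of \<open>e\<close> is linear
  in the differences that form \<open>reduced e\<close>, and the shift multiplies each of them by
  \<open>c\<close>.\<close>

lemma shifted_reduced_laplacian_mult:
  "shifted_reduced_laplacian c *\<^sub>v reduced e = reduced (\<lambda>u. vertex_laplacian G e u + c * e u)"
proof (rule eq_vecI)
  fix i assume "i < dim_vec (reduced (\<lambda>u. vertex_laplacian G e u + c * e u))"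
  hence i: "i < m" by (simp add: reduced_def)
  have lap: "vertex_laplacian G e u
      = (\<Sum>j<m. (e (v (Suc j)) - e (v 0)) * vertex_laplacian G (vertex_delta (Suc j)) u)" for u
    unfolding vertex_laplacian_expand[OF v_in[OF le0], of e u] vertex_delta_def
    by (rule sum.reindex_bij_betw[OF bij_betw_v_Suc, symmetric])
  have "(shifted_reduced_laplacian c *\<^sub>v reduced e) $ i
      = (\<Sum>j<m. (c * of_bool (i = j)
          + vertex_laplacian G (vertex_delta (Suc j)) (v (Suc i))
          - vertex_laplacian G (vertex_delta (Suc j)) (v 0)) * (e (v (Suc j)) - e (v 0)))"
    using i by (simp add: shifted_reduced_laplacian_def reduced_def scalar_prod_def atLeast0LessThan)
  also have "\<dots> = (\<Sum>j<m. if i = j then c * (e (v (Suc j)) - e (v 0)) else 0)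
      + vertex_laplacian G e (v (Suc i)) - vertex_laplacian G e (v 0)"
    unfolding lap sum.distrib[symmetric] sum_subtractf[symmetric]
    by (intro sum.cong) (auto simp: algebra_simps)
  also have "\<dots> = reduced (\<lambda>u. vertex_laplacian G e u + c * e u) $ i"
    using i by (simp add: reduced_def algebra_simps)
  finally show "(shifted_reduced_laplacian c *\<^sub>v reduced e) $ i
      = reduced (\<lambda>u. vertex_laplacian G e u + c * e u) $ i" .
qed (simp add: reduced_def shifted_reduced_laplacian_def)

text \<open>A kernel vector lifts to a function whose shifted Laplacian is constant on the graph.
  The maximum principle makes the function itself constant, so the vector is zero.\<close>

lemma det_shifted_reduced_laplacian_nonzero:
  assumes "c > 0"
  shows "det (shifted_reduced_laplacian c) \<noteq> 0"
proof
  assume "det (shifted_reduced_laplacian c) = 0"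
  then obtain x where x: "x \<in> carrier_vec m" "x \<noteq> 0\<^sub>v m" "shifted_reduced_laplacian c *\<^sub>v x = 0\<^sub>v m"
    using det_0_iff_vec_prod_zero[OF shifted_reduced_laplacian_carrier] by blast
  obtain e where e: "reduced e = x" using reduced_surj[OF x(1)] .
  have "\<forall>u\<in>pverts G. vertex_laplacian G e u + c * e u = vertex_laplacian G e (v 0) + c * e (v 0)"
    using x(3) unfolding e[symmetric] shifted_reduced_laplacian_mult reduced_eq_0_iff .
  hence "vertex_laplacian G e u + c * e u = vertex_laplacian G e (v 0) + c * e (v 0)"
    if "u \<in> pverts G" for u using that by (rule bspec)
  from shifted_laplacian_const_imp_const[OF assms this _ v_in[OF le0]]
  have "\<forall>u\<in>pverts G. e u = e (v 0)" by (intro ballI)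
  hence "reduced e = 0\<^sub>v m" by (rule reduced_eq_0_iff[THEN iffD2])
  thus False using x(2) e by simp
qed

section \<open>The characteristic polynomial through the basis of differences with the base
  vertex\<close>

definition basis_div :: "nat \<Rightarrow> 'a \<Rightarrow>\<^sub>0 int" where
  "basis_div j = frag_of (v (Suc j)) - frag_of (v 0)"

lemma lookup_basis_div:
  "Poly_Mapping.lookup (basis_div j) u = vertex_delta (Suc j) u - vertex_delta 0 u"
  by (auto simp: basis_div_def vertex_delta_def lookup_minus)

lemma basis_div_Div0:
  assumes "j < m"
  shows "basis_div j \<in> carrier (Div0 G)"
proof -
  have "Poly_Mapping.keys (basis_div j) \<subseteq> pverts G"
    using assms by (auto simp: in_keys_iff lookup_basis_div vertex_delta_def of_bool_def split: if_splits)
  thus ?thesis by (simp add: carrier_Div0 basis_div_def div_degree_diff)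
qed

text \<open>The coordinates are the values at \<open>v 1, ..., v m\<close>; the value at
  \<open>v 0\<close> is then forced by degree 0.\<close>

lemma rat_Div0_expand:
  assumes "D \<in> rat_Div0 G"
  shows "D = (\<Sum>j<m. rat_scale (Poly_Mapping.lookup D (v (Suc j))) (rat_of_div (basis_div j)))"
    (is "D = ?S")
proof (rule poly_mapping_eqI)
  fix u
  have D: "Poly_Mapping.keys D \<subseteq> pverts G" "div_degree D = 0" using assms by (auto simp: rat_Div0_def)
  have S: "Poly_Mapping.lookup ?S u
      = (\<Sum>j<m. Poly_Mapping.lookup D (v (Suc j)) * of_int (vertex_delta (Suc j) u - vertex_delta 0 u))"
    by (simp add: lookup_sum_pm lookup_basis_div)
  show "Poly_Mapping.lookup D u = Poly_Mapping.lookup ?S u"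
  proof (cases "u \<in> pverts G")
    case False
    hence "vertex_delta j u = 0" if "j \<le> m" for j using that by (auto simp: vertex_delta_def)
    moreover have "Poly_Mapping.lookup D u = 0" using D(1) False by (auto simp: in_keys_iff)
    ultimately show ?thesis unfolding S by simp
  next
    case True
    then obtain i where i: "i \<le> m" "u = v i" by (rule v_cases)
    show ?thesis
    proof (cases i)
      case 0
      have "0 = (\<Sum>x\<in>pverts G. Poly_Mapping.lookup D x)"
        using div_degree_eq[OF pair_finite_verts D(1)] D(2) by simp
      also have "\<dots> = Poly_Mapping.lookup D (v 0) + (\<Sum>x\<in>pverts G - {v 0}. Poly_Mapping.lookup D x)"
        by (rule sum.remove[OF pair_finite_verts]) simp
      also have "(\<Sum>x\<in>pverts G - {v 0}. Poly_Mapping.lookup D x)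
          = (\<Sum>j<m. Poly_Mapping.lookup D (v (Suc j)))"
        by (rule sum.reindex_bij_betw[OF bij_betw_v_Suc, symmetric])
      finally have "Poly_Mapping.lookup D (v 0) = - (\<Sum>j<m. Poly_Mapping.lookup D (v (Suc j)))"
        by simp
      also have "\<dots> = Poly_Mapping.lookup ?S u"
        unfolding S sum_negf[symmetric] using i 0 by (intro sum.cong) (auto simp: vertex_delta_def)
      finally show ?thesis using i 0 by simp
    next
      case (Suc l)
      have "Poly_Mapping.lookup ?S u = (\<Sum>j<m. if j = l then Poly_Mapping.lookup D (v (Suc j)) else 0)"
        unfolding S using i Suc by (intro sum.cong) (auto simp: vertex_delta_def)
      thus ?thesis using i Suc by simp
    qed
  qed
qed

text \<open>The polynomial may be computed in the basis \<open>basis_div\<close>, where the matrix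
  shifted by \<open>c\<close> is the transpose of \<open>shifted_reduced_laplacian c\<close>. The
  sign \<open>(- 1) ^ m\<close> from negating the matrix disappears in the absolute value.\<close>

lemma char_poly_shifted_reduced_laplacian:
  "\<bar>poly (laplacian_char_poly G) (- of_int c)\<bar> = of_int \<bar>det (shifted_reduced_laplacian c)\<bar>"
proof -
  let ?b = "\<lambda>j. rat_of_div (basis_div j)"
  define bs where "bs = map ?b [0..<m]"
  define A :: "rat mat" where
    "A = mat m m (\<lambda>(i, j). Poly_Mapping.lookup (rat_laplacian G (?b j)) (v (Suc i)))"
  have len: "length bs = m" and nth: "\<And>j. j < m \<Longrightarrow> bs ! j = ?b j" by (auto simp: bs_def)
  \<comment> \<open>Evaluation at \<open>v (Suc i)\<close> gives the dual basis, which settles both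
    distinctness and independence.\<close>
  have lookup_b: "Poly_Mapping.lookup (?b j) (v (Suc i)) = of_bool (i = j)" if "i < m" "j < m" for i j
    using that by (simp add: lookup_basis_div vertex_delta_def)
  have inj: "inj_on ?b {..<m}"
  proof (rule inj_onI)
    fix i j assume ij: "i \<in> {..<m}" "j \<in> {..<m}" and "?b i = ?b j"
    hence "Poly_Mapping.lookup (?b i) (v (Suc i)) = Poly_Mapping.lookup (?b j) (v (Suc i))" by simp
    thus "i = j" using ij by (simp add: lookup_b del: lookup_rat_of_div)
  qed
  have set_bs: "set bs = ?b ` {..<m}" by (auto simp: bs_def)
  have dist: "distinct bs" using inj by (auto simp: bs_def distinct_map atLeast0LessThan)
  have indep: "\<not> rat_vs.dependent (set bs)"
  proof
    assume "rat_vs.dependent (set bs)"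
    then obtain f j where f: "(\<Sum>x\<in>set bs. rat_scale (f x) x) = 0" and j: "j < m" "f (?b j) \<noteq> 0"
      by (auto simp: rat_vs.dependent_finite set_bs)
    have "0 = Poly_Mapping.lookup (\<Sum>x\<in>set bs. rat_scale (f x) x) (v (Suc j))" by (simp add: f)
    also have "\<dots> = (\<Sum>i<m. f (?b i) * Poly_Mapping.lookup (?b i) (v (Suc j)))"
      unfolding lookup_sum_pm set_bs by (simp only: sum.reindex[OF inj] o_def lookup_rat_scale)
    also have "\<dots> = (\<Sum>i<m. if i = j then f (?b i) else 0)"
      using j by (intro sum.cong) (auto simp: lookup_b simp del: lookup_rat_of_div)
    finally show False using j by simp
  qed
  have span: "rat_vs.span (set bs) = rat_Div0 G"
  proof (rule rat_vs.span_subspace[OF _ _ subspace_rat_Div0])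
    show "set bs \<subseteq> rat_Div0 G" by (auto simp: set_bs rat_of_div_Div0 basis_div_Div0)
    show "rat_Div0 G \<subseteq> rat_vs.span (set bs)"
    proof
      fix D assume "D \<in> rat_Div0 G"
      from rat_Div0_expand[OF this] show "D \<in> rat_vs.span (set bs)"
        by (elim ssubst) (intro rat_vs.span_sum rat_vs.span_scale rat_vs.span_base, simp add: set_bs)
    qed
  qed
  have "represents rat_scale (rat_Div0 G) (rat_laplacian G) bs A"
    unfolding represents_def len
  proof (intro conjI dist indep span allI impI)
    show "A \<in> carrier_mat m m" by (simp add: A_def)
    fix j assume j: "j < m"
    have "?b j \<in> rat_Div0 G" using j by (simp add: rat_of_div_Div0 basis_div_Div0)
    hence "rat_laplacian G (?b j) \<in> rat_Div0 G"
      by (intro rat_laplacian_in_rat_Div0) (simp add: rat_Div0_def)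
    from rat_Div0_expand[OF this]
    show "rat_laplacian G (bs ! j) = (\<Sum>i<m. rat_scale (A $$ (i, j)) (bs ! i))"
      using j by (simp add: nth A_def)
  qed
  hence cp: "laplacian_char_poly G = char_poly A"
    unfolding laplacian_char_poly_def by (rule rat_vs.endo_char_poly_eq[OF linear_rat_laplacian])
  have A: "A \<in> carrier_mat m m" by (simp add: A_def)
  \<comment> \<open>Symmetry turns a difference of two columns of the Laplacian into a difference of
    two rows, the form of an entry of the reduced matrix with \<open>i\<close> and \<open>j\<close>
    exchanged.\<close>
  have entry: "Poly_Mapping.lookup (rat_laplacian G (?b j)) (v (Suc i))
      = of_int (vertex_laplacian G (vertex_delta (Suc i)) (v (Suc j))
          - vertex_laplacian G (vertex_delta (Suc i)) (v 0))" for i j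
  proof -
    have "Poly_Mapping.lookup (laplacian G (basis_div j)) (v (Suc i))
        = vertex_laplacian G (vertex_delta (Suc j)) (v (Suc i))
          - vertex_laplacian G (vertex_delta 0) (v (Suc i))"
      unfolding lookup_laplacian lookup_basis_div vertex_laplacian_def sum_subtractf[symmetric]
      by (intro sum.cong) auto
    also have "\<dots> = vertex_laplacian G (vertex_delta (Suc i)) (v (Suc j))
          - vertex_laplacian G (vertex_delta (Suc i)) (v 0)"
      unfolding vertex_delta_def using vertex_laplacian_symmetric by simp
    finally show ?thesis by (simp only: rat_laplacian_rat_of_div lookup_rat_of_div)
  qed
  \<comment> \<open>\<open>char_matrix A (- of_int c)\<close> is \<open>A\<close> plus
    \<open>c\<close> times the identity, and the characteristic polynomial at
    \<open>- of_int c\<close> is the determinant of its negative.\<close>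
  have "- char_matrix A (- of_int c)
      = (- 1) \<cdot>\<^sub>m transpose_mat (map_mat of_int (shifted_reduced_laplacian c))"
    using A by (intro eq_matI) (auto simp: char_matrix_def A_def entry shifted_reduced_laplacian_def)
  hence "poly (char_poly A) (- of_int c)
      = (- 1) ^ m * det (map_mat of_int (shifted_reduced_laplacian c) :: rat mat)"
    unfolding char_poly_matrix[OF A] using det_transpose[of "map_mat of_int (shifted_reduced_laplacian c) :: rat mat" m]
      carrier_matD[OF shifted_reduced_laplacian_carrier] by (simp add: det_smult)
  thus ?thesis unfolding cp by (simp add: abs_mult of_int_hom.hom_det)
qed

end

section \<open>Picard groups as quotients\<close>

lemma mult_Div0 [simp]: "D \<otimes>\<^bsub>Div0 G\<^esub> E = D + E"
  and one_Div0 [simp]: "\<one>\<^bsub>Div0 G\<^esub> = 0"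
  by (simp_all add: Div0_def Div_def)

lemma comm_group_Div0: "comm_group (Div0 G)"
proof (rule comm_groupI)
  fix D E assume "D \<in> carrier (Div0 G)" "E \<in> carrier (Div0 G)"
  thus "D \<otimes>\<^bsub>Div0 G\<^esub> E \<in> carrier (Div0 G)"
    using Poly_Mapping.keys_add[of D E] by (auto simp: carrier_Div0 div_degree_add)
next
  fix D assume "D \<in> carrier (Div0 G)"
  thus "\<exists>E\<in>carrier (Div0 G). E \<otimes>\<^bsub>Div0 G\<^esub> D = \<one>\<^bsub>Div0 G\<^esub>"
    by (intro bexI[of _ "- D"]) (auto simp: carrier_Div0 div_degree_uminus)
qed (auto simp: carrier_Div0 algebra_simps)

lemma inv_Div0 [simp]:
  assumes "D \<in> carrier (Div0 G)"
  shows "inv\<^bsub>Div0 G\<^esub> D = - D"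
proof -
  interpret comm_group "Div0 G" by (rule comm_group_Div0)
  show ?thesis
    using assms by (intro inv_equality) (auto simp: carrier_Div0 div_degree_uminus)
qed

lemma sum_Div0:
  assumes "\<And>i. i \<in> I \<Longrightarrow> f i \<in> carrier (Div0 G)"
  shows "(\<Sum>i\<in>I. f i) \<in> carrier (Div0 G)"
  using assms
proof (induction I rule: infinite_finite_induct)
  case (insert i I)
  interpret comm_group "Div0 G" by (rule comm_group_Div0)
  show ?case using insert m_closed[of "f i" "\<Sum>i\<in>I. f i"] by simp
qed (simp_all add: carrier_Div0)

lemma frag_cmul_diff_Div0:
  assumes "x \<in> pverts G" "y \<in> pverts G"
  shows "frag_cmul c (frag_of x - frag_of y) \<in> carrier (Div0 G)"
proof -
  have eq: "frag_cmul c (frag_of x - frag_of y) = Poly_Mapping.single x c - Poly_Mapping.single y c"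
    by (rule poly_mapping_eqI) (auto simp: lookup_minus lookup_single when_def)
  show ?thesis using assms unfolding eq
    by (auto simp: carrier_Div0 div_degree_diff in_keys_iff lookup_minus lookup_single when_def
        split: if_splits)
qed

lemma laplacian_add: "laplacian G (D + E) = laplacian G D + laplacian G E"
  and laplacian_diff: "laplacian G (D - E) = laplacian G D - laplacian G E"
  and laplacian_uminus: "laplacian G (- D) = - laplacian G D"
  and laplacian_0 [simp]: "laplacian G 0 = 0"
  by (simp_all add: laplacian_def frag_extend_add frag_extend_diff frag_extend_minus)

lemma (in pair_graph) subgroup_image_laplacian:
  "subgroup (laplacian G ` carrier (Div G)) (Div0 G)"
proof
  show "laplacian G ` carrier (Div G) \<subseteq> carrier (Div0 G)" using laplacian_in_Div0 by blast
  show "\<one>\<^bsub>Div0 G\<^esub> \<in> laplacian G ` carrier (Div G)"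
    by (rule image_eqI[of _ _ 0]) (auto simp: Div_def)
next
  fix x y assume "x \<in> laplacian G ` carrier (Div G)" "y \<in> laplacian G ` carrier (Div G)"
  then obtain D E where "D \<in> carrier (Div G)" "E \<in> carrier (Div G)"
    "x = laplacian G D" "y = laplacian G E" by blast
  thus "x \<otimes>\<^bsub>Div0 G\<^esub> y \<in> laplacian G ` carrier (Div G)"
    using Poly_Mapping.keys_add[of D E]
    by (intro image_eqI[of _ _ "D + E"]) (auto simp: laplacian_add Div_def)
next
  fix x assume "x \<in> laplacian G ` carrier (Div G)"
  then obtain D where D: "D \<in> carrier (Div G)" "x = laplacian G D" by blast
  thus "inv\<^bsub>Div0 G\<^esub> x \<in> laplacian G ` carrier (Div G)"
    using laplacian_in_Div0[of D]
    by (intro image_eqI[of _ _ "- D"]) (auto simp: laplacian_uminus Div_def)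
qed

lemma (in group_hom) hom_eq_iff:
  assumes "x \<in> carrier G" "y \<in> carrier G"
  shows "h x = h y \<longleftrightarrow> h (x \<otimes>\<^bsub>G\<^esub> inv\<^bsub>G\<^esub> y) = \<one>\<^bsub>H\<^esub>"
  using assms H.inv_solve_right[of "\<one>\<^bsub>H\<^esub>" "h x" "h y"] by (auto simp: eq_commute)

lemma (in comm_group) group_hom_quotient:
  assumes "subgroup N G"
  shows "group_hom G (G Mod N) (\<lambda>x. N #> x)"
proof -
  interpret normal N G using assms by (rule subgroup_imp_normal)
  show ?thesis
    by (intro group_hom.intro group_hom_axioms.intro is_group factorgroup_is_group r_coset_hom_Mod)
qed

lemma (in group) rcos_eq_one_iff:
  assumes "subgroup N G" "x \<in> carrier G"
  shows "N #> x = \<one>\<^bsub>G Mod N\<^esub> \<longleftrightarrow> x \<in> N"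
  using assms coset_join1 coset_join2 by auto

text \<open>With the cokernel of \<open>f\<close> as third group, exactness in the middle and
  surjectivity are automatic; only the injectivity of \<open>f\<close> has content.\<close>

lemma short_exact_quotient:
  assumes "comm_group A" "comm_group B" "f \<in> mon A B"
  shows "short_exact_comm_groups A f B (\<lambda>x. f ` carrier A #>\<^bsub>B\<^esub> x) (B Mod f ` carrier A)"
proof -
  interpret A: comm_group A by fact
  interpret B: comm_group B by fact
  interpret f: group_hom A B f using assms(3) by unfold_locales (simp add: mon_def)
  have sub: "subgroup (f ` carrier A) B" by (rule f.img_is_subgroup)
  interpret q: group_hom B "B Mod f ` carrier A" "\<lambda>x. f ` carrier A #>\<^bsub>B\<^esub> x"
    by (rule B.group_hom_quotient[OF sub])
  have "f ` carrier A = kernel B (B Mod f ` carrier A) (\<lambda>x. f ` carrier A #>\<^bsub>B\<^esub> x)"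
    using B.rcos_eq_one_iff[OF sub] subgroup.subset[OF sub] by (auto simp: kernel_def)
  thus ?thesis
    using assms B.abelian_FactGroup[OF sub] q.homh
    by (simp add: short_exact_comm_groups_def epi_def carrier_FactGroup)
qed

section \<open>The cone\<close>

text \<open>Here \<open>Suc l\<close> and \<open>Suc m\<close> are the numbers \<open>n\<close> and
  \<open>k\<close> of the theorem, and \<open>w 0\<close> is the base vertex among the apex
  vertices.\<close>

locale cone = enumerated_graph G v m for G :: "'a pair_pre_digraph" and v m +
  fixes K :: "'b pair_pre_digraph" and w :: "nat \<Rightarrow> 'b" and l :: nat
  assumes complete: "complete_digraph (Suc l) (with_proj K)"
    and enum_K: "bij_betw w {..l} (pverts K)"
begin

abbreviation J :: "('a + 'b) pair_pre_digraph" where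
  "J \<equiv> graph_join G K"

definition size_J :: int where
  "size_J = int (Suc l + Suc m)"

lemmas K_props = complete_pair_digraph[OF complete]

sublocale J: pair_graph J
  by (intro pair_graph_join K_props) unfold_locales

lemma w_in [simp]: "i \<le> l \<Longrightarrow> w i \<in> pverts K"
  using enum_K by (auto simp: bij_betw_def)

lemma w_eq_iff [simp]: "i \<le> l \<Longrightarrow> j \<le> l \<Longrightarrow> w i = w j \<longleftrightarrow> i = j"
  using enum_K by (auto simp: bij_betw_def inj_on_eq_iff)

lemma pverts_J: "pverts J = Inl ` pverts G \<union> Inr ` pverts K"
  by (auto simp: graph_join_def)

lemma card_G: "card (pverts G) = Suc m"
  using bij_betw_same_card[OF enum] by simp

lemma sum_pverts_J:
  "(\<Sum>x\<in>pverts J. f x) = (\<Sum>u\<in>pverts G. f (Inl u)) + (\<Sum>y\<in>pverts K. f (Inr y))"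
  unfolding pverts_J using pair_finite_verts K_props(2)
  by (subst sum.union_disjoint) (auto simp: sum.reindex)

text \<open>A vertex of \<open>G\<close> gains all apex vertices as neighbours, hence the shift by
  \<open>Suc l\<close>. The last sum is the same for every \<open>u\<close>, so it disappears modulo
  constants.\<close>

lemma lookup_laplacian_Inl:
  assumes "u \<in> pverts G"
  shows "Poly_Mapping.lookup (laplacian J D) (Inl u)
    = vertex_laplacian G (\<lambda>x. Poly_Mapping.lookup D (Inl x)) u
      + int (Suc l) * Poly_Mapping.lookup D (Inl u) - (\<Sum>y\<in>pverts K. Poly_Mapping.lookup D (Inr y))"
proof -
  have "{x. (x, Inl u) \<in> parcs J} = Inl ` {x. (x, u) \<in> parcs G} \<union> Inr ` pverts K"
    using assms by (auto simp: graph_join_def)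
  hence "Poly_Mapping.lookup (laplacian J D) (Inl u)
      = vertex_laplacian G (\<lambda>x. Poly_Mapping.lookup D (Inl x)) u
      + (\<Sum>y\<in>pverts K. Poly_Mapping.lookup D (Inl u) - Poly_Mapping.lookup D (Inr y))"
    unfolding J.lookup_laplacian vertex_laplacian_def using K_props(2)
    by (simp, subst sum.union_disjoint) (auto simp: sum.reindex)
  thus ?thesis using K_props(3) by (simp add: sum_subtractf)
qed

text \<open>An apex vertex is adjacent to all other vertices of the cone, so the differences may be
  summed over the whole vertex set.\<close>

lemma lookup_laplacian_Inr:
  assumes "y \<in> pverts K" "Poly_Mapping.keys D \<subseteq> pverts J"
  shows "Poly_Mapping.lookup (laplacian J D) (Inr y)
    = size_J * Poly_Mapping.lookup D (Inr y) - div_degree D"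
proof -
  have "{x. (x, Inr y) \<in> parcs J} = pverts J - {Inr y}"
    using assms K_props(4) by (auto simp: graph_join_def)
  hence "Poly_Mapping.lookup (laplacian J D) (Inr y)
      = (\<Sum>x\<in>pverts J - {Inr y}. Poly_Mapping.lookup D (Inr y) - Poly_Mapping.lookup D x)"
    by (simp add: J.lookup_laplacian)
  also have "\<dots> = (\<Sum>x\<in>pverts J. Poly_Mapping.lookup D (Inr y) - Poly_Mapping.lookup D x)"
    using J.pair_finite_verts by (intro sum.mono_neutral_left) auto
  also have "\<dots> = (\<Sum>x\<in>pverts J. Poly_Mapping.lookup D (Inr y)) - div_degree D"
    unfolding div_degree_eq[OF J.pair_finite_verts assms(2)] by (simp add: sum_subtractf)
  also have "(\<Sum>x\<in>pverts J. Poly_Mapping.lookup D (Inr y)) = size_J * Poly_Mapping.lookup D (Inr y)"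
    unfolding sum_pverts_J using card_G K_props(3) by (simp add: size_J_def algebra_simps)
  finally show ?thesis .
qed

section \<open>Divisors of degree 0 supported on the apex vertices\<close>

definition apex_div :: "(nat \<Rightarrow> int) \<Rightarrow> ('a + 'b \<Rightarrow>\<^sub>0 int)" where
  "apex_div a = (\<Sum>i<l. frag_cmul (a i) (frag_of (Inr (w (Suc i))) - frag_of (Inr (w 0))))"

lemma lookup_apex_div_Inl [simp]: "Poly_Mapping.lookup (apex_div a) (Inl u) = 0"
  by (simp add: apex_div_def lookup_sum_pm lookup_minus)

lemma lookup_apex_div_w [simp]:
  assumes "i < l"
  shows "Poly_Mapping.lookup (apex_div a) (Inr (w (Suc i))) = a i"
proof -
  have "Poly_Mapping.lookup (apex_div a) (Inr (w (Suc i))) = (\<Sum>j<l. if j = i then a j else 0)"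
    unfolding apex_div_def lookup_sum_pm using assms
    by (intro sum.cong) (auto simp: lookup_minus)
  thus ?thesis using assms by simp
qed

lemma apex_div_Div0: "apex_div a \<in> carrier (Div0 J)"
  unfolding apex_div_def by (intro sum_Div0 frag_cmul_diff_Div0) (auto simp: pverts_J)

lemma lookup_apex_div_outside:
  assumes "y \<notin> pverts K"
  shows "Poly_Mapping.lookup (apex_div a) (Inr y) = 0"
  using apex_div_Div0[of a] assms by (auto simp: carrier_Div0 in_keys_iff pverts_J)

lemma apex_div_add: "apex_div (\<lambda>i. a i + b i) = apex_div a + apex_div b"
  by (simp add: apex_div_def frag_cmul_distrib sum.distrib)

lemma apex_div_cong: "(\<And>i. i < l \<Longrightarrow> a i = b i) \<Longrightarrow> apex_div a = apex_div b"
  unfolding apex_div_def by (intro sum.cong) auto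

text \<open>Removing the coefficients at \<open>w 1, ..., w l\<close> leaves a multiple of
  \<open>w 0\<close>, which is zero because its degree is.\<close>

lemma apex_div_exhausts:
  assumes "D \<in> carrier (Div0 J)" "\<And>u. u \<in> pverts G \<Longrightarrow> Poly_Mapping.lookup D (Inl u) = 0"
  shows "D = apex_div (\<lambda>i. Poly_Mapping.lookup D (Inr (w (Suc i))))"
proof -
  define E where "E = D - apex_div (\<lambda>i. Poly_Mapping.lookup D (Inr (w (Suc i))))"
  have D: "Poly_Mapping.keys D \<subseteq> pverts J" using assms(1) by (simp add: carrier_Div0)
  have "x = Inr (w 0)" if x: "Poly_Mapping.lookup E x \<noteq> 0" for x
  proof (cases x)
    case (Inl u)
    have "Poly_Mapping.lookup D x = 0"
      using assms(2)[of u] D Inl by (cases "u \<in> pverts G") (auto simp: in_keys_iff pverts_J)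
    thus ?thesis using x Inl by (simp add: E_def lookup_minus)
  next
    case (Inr y)
    have "y \<in> pverts K"
    proof (rule ccontr)
      assume y: "y \<notin> pverts K"
      hence "Poly_Mapping.lookup D x = 0" using D Inr by (auto simp: in_keys_iff pverts_J)
      thus False using x Inr lookup_apex_div_outside[OF y] by (simp add: E_def lookup_minus)
    qed
    then obtain i where i: "i \<le> l" "y = w i" using enum_K by (auto simp: bij_betw_def)
    show ?thesis
      using x Inr i by (cases i) (auto simp: E_def lookup_minus)
  qed
  hence keys: "Poly_Mapping.keys E \<subseteq> {Inr (w 0)}" by (auto simp: in_keys_iff)
  have "div_degree E = 0"
    using assms(1) apex_div_Div0 by (simp add: E_def div_degree_diff carrier_Div0)
  hence "Poly_Mapping.lookup E (Inr (w 0)) = 0" using div_degree_eq[OF _ keys] by simp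
  hence "E = 0" using keys by (intro poly_mapping_eqI) (auto simp: in_keys_iff)
  thus ?thesis by (simp add: E_def)
qed

lemma laplacian_apex_div: "laplacian J (apex_div c) = apex_div (\<lambda>i. size_J * c i)"
proof -
  have c: "Poly_Mapping.keys (apex_div c) \<subseteq> pverts J" "div_degree (apex_div c) = 0"
    using apex_div_Div0[of c] by (auto simp: carrier_Div0)
  have "(\<Sum>y\<in>pverts K. Poly_Mapping.lookup (apex_div c) (Inr y)) = 0"
    using div_degree_eq[OF J.pair_finite_verts c(1)] c(2) by (simp add: sum_pverts_J)
  hence "Poly_Mapping.lookup (laplacian J (apex_div c)) (Inl u) = 0" if "u \<in> pverts G" for u
    unfolding lookup_laplacian_Inl[OF that] by (simp add: vertex_laplacian_def)
  moreover have "laplacian J (apex_div c) \<in> carrier (Div0 J)"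
    using c by (intro J.laplacian_in_Div0) (simp add: Div_def)
  ultimately have "laplacian J (apex_div c)
      = apex_div (\<lambda>i. Poly_Mapping.lookup (laplacian J (apex_div c)) (Inr (w (Suc i))))"
    by (intro apex_div_exhausts)
  also have "\<dots> = apex_div (\<lambda>i. size_J * c i)"
    by (rule apex_div_cong) (simp add: lookup_laplacian_Inr c)
  finally show ?thesis .
qed

text \<open>Vanishing on \<open>G\<close> makes the shifted Laplacian of \<open>E\<close> constant
  there, so \<open>E\<close> has a constant value \<open>c\<close> on \<open>G\<close> by the
  maximum principle. Then the apex values sum to \<open>Suc l\<close> times \<open>c\<close>, the
  degree of \<open>E\<close> is \<open>size_J * c\<close>, and each apex coefficient is a multiple
  of \<open>size_J\<close>.\<close>

lemma apex_div_principal_imp_dvd: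
  assumes "E \<in> carrier (Div J)" "apex_div a = laplacian J E" "i < l"
  shows "size_J dvd a i"
proof -
  have E: "Poly_Mapping.keys E \<subseteq> pverts J" using assms(1) by (simp add: Div_def)
  let ?e = "\<lambda>u. Poly_Mapping.lookup E (Inl u)"
  let ?s = "\<Sum>y\<in>pverts K. Poly_Mapping.lookup E (Inr y)"
  define c where "c = ?e (v 0)"
  have s: "vertex_laplacian G ?e u + int (Suc l) * ?e u = ?s" if "u \<in> pverts G" for u
    using lookup_laplacian_Inl[OF that, of E] lookup_apex_div_Inl[of a u] assms(2) by simp
  have e: "?e u = c" if "u \<in> pverts G" for u
    unfolding c_def by (rule shifted_laplacian_const_imp_const[OF _ s that]) auto
  have "vertex_laplacian G ?e (v 0) = 0"
    unfolding vertex_laplacian_def by (intro sum.neutral) (auto simp: e dest: in_arcsD1 in_arcsD2)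
  hence "?s = int (Suc l) * c" using s[of "v 0"] by (simp add: c_def)
  moreover have "(\<Sum>u\<in>pverts G. ?e u) = int (Suc m) * c" using card_G by (simp add: e)
  ultimately have "div_degree E = size_J * c"
    unfolding div_degree_eq[OF J.pair_finite_verts E] sum_pverts_J
    by (simp add: size_J_def algebra_simps)
  hence "a i = size_J * (Poly_Mapping.lookup E (Inr (w (Suc i))) - c)"
    using lookup_laplacian_Inr[of "w (Suc i)" E] E assms(2,3) lookup_apex_div_w[OF assms(3), of a]
    by (simp add: algebra_simps)
  thus ?thesis by simp
qed

section \<open>Restriction of divisors to the base graph\<close>

abbreviation restrict_G :: "('a + 'b \<Rightarrow>\<^sub>0 int) \<Rightarrow> 'a \<Rightarrow> int" where
  "restrict_G D \<equiv> \<lambda>u. Poly_Mapping.lookup D (Inl u)"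

lemma reduced_laplacian_J:
  "reduced (restrict_G (laplacian J E))
     = shifted_reduced_laplacian (int (Suc l)) *\<^sub>v reduced (restrict_G E)"
  unfolding shifted_reduced_laplacian_mult
  by (intro eq_vecI) (auto simp: reduced_def lookup_laplacian_Inl)

lemma reduced_restrict_surj:
  assumes "x \<in> carrier_vec m"
  obtains D where "D \<in> carrier (Div0 J)" "reduced (restrict_G D) = x"
proof -
  obtain e where e: "reduced e = x" using reduced_surj[OF assms] .
  \<comment> \<open>The values on \<open>G\<close> are prescribed freely, and each is balanced at
    \<open>w 0\<close> to keep the degree 0.\<close>
  let ?E = "\<Sum>u\<in>pverts G. frag_cmul (e u) (frag_of (Inl u) - frag_of (Inr (w 0)))"
  have E: "Poly_Mapping.lookup ?E (Inl u) = e u" if "u \<in> pverts G" for u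
  proof -
    have "Poly_Mapping.lookup ?E (Inl u) = (\<Sum>x\<in>pverts G. if x = u then e x else 0)"
      unfolding lookup_sum_pm by (intro sum.cong) (auto simp: lookup_minus)
    thus ?thesis using that pair_finite_verts by simp
  qed
  have "?E \<in> carrier (Div0 J)"
    by (intro sum_Div0 frag_cmul_diff_Div0) (auto simp: pverts_J)
  moreover have "reduced (restrict_G ?E) = reduced e"
    by (intro eq_vecI) (auto simp: reduced_def E)
  ultimately show ?thesis using that e by blast
qed

text \<open>Apex divisors vanish on \<open>G\<close>, which gives one direction. Conversely, a
  preimage of the vector yields \<open>F\<close> whose Laplacian agrees with \<open>D\<close> on
  \<open>G\<close> up to a constant; a multiple of \<open>w 0\<close> absorbs the constant, and what
  remains is an apex divisor.\<close>

lemma reduced_in_lattice_iff: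
  assumes D: "D \<in> carrier (Div0 J)"
  shows "(\<exists>a. \<exists>E\<in>carrier (Div J). D = apex_div a + laplacian J E) \<longleftrightarrow>
    reduced (restrict_G D) \<in> column_lattice (shifted_reduced_laplacian (int (Suc l)))"
proof
  assume "\<exists>a. \<exists>E\<in>carrier (Div J). D = apex_div a + laplacian J E"
  then obtain a E where "D = apex_div a + laplacian J E" by blast
  hence "restrict_G D = restrict_G (laplacian J E)" by (simp add: lookup_add)
  thus "reduced (restrict_G D) \<in> column_lattice (shifted_reduced_laplacian (int (Suc l)))"
    unfolding column_lattice_def
    by (simp add: reduced_laplacian_J carrier_matD[OF shifted_reduced_laplacian_carrier])
next
  assume "reduced (restrict_G D) \<in> column_lattice (shifted_reduced_laplacian (int (Suc l)))"
  then obtain x where x: "x \<in> carrier_vec m"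
      "reduced (restrict_G D) = shifted_reduced_laplacian (int (Suc l)) *\<^sub>v x"
    by (auto simp: column_lattice_def carrier_matD[OF shifted_reduced_laplacian_carrier])
  obtain F where F: "F \<in> carrier (Div0 J)" "reduced (restrict_G F) = x"
    using reduced_restrict_surj[OF x(1)] .
  have FJ: "Poly_Mapping.keys F \<subseteq> pverts J" using F by (simp add: carrier_Div0)
  have "reduced (\<lambda>u. restrict_G D u - restrict_G (laplacian J F) u) = 0\<^sub>v m"
    unfolding reduced_diff reduced_laplacian_J F(2) x(2)[symmetric] by simp
  then obtain c where c: "\<And>u. u \<in> pverts G \<Longrightarrow> restrict_G D u - restrict_G (laplacian J F) u = c"
    unfolding reduced_eq_0_iff by blast
  \<comment> \<open>The Laplacian of \<open>w 0\<close> is \<open>-1\<close> at every vertex of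
    \<open>G\<close>, so subtracting \<open>c\<close> copies raises the Laplacian there by exactly
    \<open>c\<close>.\<close>
  define E where "E = F - frag_cmul c (frag_of (Inr (w 0)))"
  have E: "E \<in> carrier (Div J)"
    using FJ Poly_Mapping.keys_diff[of F "frag_cmul c (frag_of (Inr (w 0)))"]
    by (auto simp: E_def Div_def pverts_J)
  define A where "A = D - laplacian J E"
  have "A \<in> carrier (Div0 J)"
  proof -
    interpret D: comm_group "Div0 J" by (rule comm_group_Div0)
    have "D \<otimes>\<^bsub>Div0 J\<^esub> inv\<^bsub>Div0 J\<^esub> laplacian J E \<in> carrier (Div0 J)"
      using D J.laplacian_in_Div0[OF E] by (intro D.m_closed D.inv_closed)
    thus ?thesis using J.laplacian_in_Div0[OF E] by (simp add: A_def)
  qed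
  moreover have "Poly_Mapping.lookup A (Inl u) = 0" if u: "u \<in> pverts G" for u
  proof -
    have "Poly_Mapping.lookup (laplacian J (frag_cmul c (frag_of (Inr (w 0))))) (Inl u) = - c"
      unfolding lookup_laplacian_Inl[OF u] using K_props(2)
      by (simp add: vertex_laplacian_def sum.delta if_distrib cong: if_cong)
    thus ?thesis using c[OF u] by (simp add: A_def E_def laplacian_diff lookup_minus)
  qed
  ultimately have "A = apex_div (\<lambda>i. Poly_Mapping.lookup A (Inr (w (Suc i))))"
    by (rule apex_div_exhausts)
  hence "D = apex_div (\<lambda>i. Poly_Mapping.lookup A (Inr (w (Suc i)))) + laplacian J E"
    by (simp add: A_def)
  thus "\<exists>a. \<exists>E\<in>carrier (Div J). D = apex_div a + laplacian J E" using E by blast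
qed

section \<open>Classes of apex divisors in the Picard group\<close>

definition pic_class :: "('a + 'b \<Rightarrow>\<^sub>0 int) \<Rightarrow> ('a + 'b \<Rightarrow>\<^sub>0 int) set" where
  "pic_class D = laplacian J ` carrier (Div J) #>\<^bsub>Div0 J\<^esub> D"

lemma comm_group_Pic0: "comm_group (Pic0 J)"
  unfolding Pic0_def
  by (rule comm_group.abelian_FactGroup[OF comm_group_Div0 J.subgroup_image_laplacian])

lemma group_hom_pic_class: "group_hom (Div0 J) (Pic0 J) pic_class"
  unfolding Pic0_def pic_class_def
  by (rule comm_group.group_hom_quotient[OF comm_group_Div0 J.subgroup_image_laplacian])

lemma carrier_Pic0: "carrier (Pic0 J) = pic_class ` carrier (Div0 J)"
  by (simp add: Pic0_def pic_class_def carrier_FactGroup)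

lemma pic_class_eq_iff:
  assumes "D \<in> carrier (Div0 J)" "E \<in> carrier (Div0 J)"
  shows "pic_class D = pic_class E \<longleftrightarrow> D - E \<in> laplacian J ` carrier (Div J)"
proof -
  interpret D: comm_group "Div0 J" by (rule comm_group_Div0)
  interpret h: group_hom "Div0 J" "Pic0 J" pic_class by (rule group_hom_pic_class)
  have "D - E = D \<otimes>\<^bsub>Div0 J\<^esub> inv\<^bsub>Div0 J\<^esub> E" using assms by simp
  also have "\<dots> \<in> carrier (Div0 J)" using assms by (intro D.m_closed D.inv_closed)
  finally have "D - E \<in> carrier (Div0 J)" .
  thus ?thesis
    using h.hom_eq_iff[OF assms] assms D.rcos_eq_one_iff[OF J.subgroup_image_laplacian]
    by (simp add: pic_class_def Pic0_def)
qed

text \<open>By \<open>laplacian_apex_div\<close>, \<open>size_J\<close> times an apex divisor is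
  principal, so only the residues of the coefficients matter.\<close>

lemma pic_class_apex_div_eqI:
  assumes "\<And>i. i < l \<Longrightarrow> a i mod size_J = b i mod size_J"
  shows "pic_class (apex_div a) = pic_class (apex_div b)"
proof -
  have "a i = b i + size_J * ((a i - b i) div size_J)" if "i < l" for i
    using assms[OF that] by (simp add: mod_eq_dvd_iff)
  hence "apex_div a = apex_div (\<lambda>i. b i + size_J * ((a i - b i) div size_J))"
    by (rule apex_div_cong)
  hence "apex_div a - apex_div b = laplacian J (apex_div (\<lambda>i. (a i - b i) div size_J))"
    by (simp add: apex_div_add laplacian_apex_div)
  moreover have "apex_div (\<lambda>i. (a i - b i) div size_J) \<in> carrier (Div J)"
    using apex_div_Div0 by (simp add: carrier_Div0 Div_def)
  ultimately show ?thesis unfolding pic_class_eq_iff[OF apex_div_Div0 apex_div_Div0] by blast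
qed

abbreviation apex_group :: "(nat \<Rightarrow> int) monoid" where
  "apex_group \<equiv> product_group {..<l} (\<lambda>_. integer_mod_group (Suc l + Suc m))"

lemma comm_group_apex_group: "comm_group apex_group"
  by (intro group.group_comm_groupI) (auto simp: fun_eq_iff add.commute)

text \<open>Elements of the product carry representatives between 0 and \<open>size_J - 1\<close>.
  Reducing a sum does not change its class, and a coefficient in this range that
  \<open>size_J\<close> divides is 0.\<close>

lemma apex_group_mon: "(\<lambda>a. pic_class (apex_div a)) \<in> mon apex_group (Pic0 J)"
proof -
  interpret A: comm_group apex_group by (rule comm_group_apex_group)
  interpret P: comm_group "Pic0 J" by (rule comm_group_Pic0)
  interpret h: group_hom "Div0 J" "Pic0 J" pic_class by (rule group_hom_pic_class)
  have "(\<lambda>a. pic_class (apex_div a)) \<in> hom apex_group (Pic0 J)"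
  proof (rule homI)
    fix a b assume "a \<in> carrier apex_group" "b \<in> carrier apex_group"
    have "pic_class (apex_div (a \<otimes>\<^bsub>apex_group\<^esub> b)) = pic_class (apex_div (\<lambda>i. a i + b i))"
      by (rule pic_class_apex_div_eqI) (simp add: size_J_def)
    thus "pic_class (apex_div (a \<otimes>\<^bsub>apex_group\<^esub> b))
        = pic_class (apex_div a) \<otimes>\<^bsub>Pic0 J\<^esub> pic_class (apex_div b)"
      using h.hom_mult[OF apex_div_Div0 apex_div_Div0, of a b] by (simp add: apex_div_add)
  qed (simp add: carrier_Pic0 apex_div_Div0)
  moreover have "a = \<one>\<^bsub>apex_group\<^esub>"
    if a: "a \<in> carrier apex_group" and one: "pic_class (apex_div a) = \<one>\<^bsub>Pic0 J\<^esub>" for a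
  proof -
    have "pic_class (apex_div a) = pic_class 0" using one h.hom_one by simp
    moreover have "0 \<in> carrier (Div0 J)" by (simp add: carrier_Div0)
    ultimately obtain E where E: "E \<in> carrier (Div J)" "apex_div a = laplacian J E"
      using pic_class_eq_iff[OF apex_div_Div0, of 0 a] by auto
    have "a i = 0" if "i < l" for i
    proof -
      have "0 \<le> a i" "a i < size_J"
        using a that by (auto simp: size_J_def carrier_integer_mod_group PiE_iff)
      thus ?thesis using apex_div_principal_imp_dvd[OF E that] zdvd_not_zless[of "a i" size_J] by force
    qed
    thus ?thesis using a by (auto simp: fun_eq_iff PiE_iff extensional_def)
  qed
  ultimately show ?thesis
    using mon_iff_hom_one[OF A.is_group P.is_group] by blast
qed

section \<open>The quotient by the apex subgroup and its order\<close>

definition apex_subgroup :: "('a + 'b \<Rightarrow>\<^sub>0 int) set set" where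
  "apex_subgroup = (\<lambda>a. pic_class (apex_div a)) ` carrier apex_group"

lemma pic_class_in_apex_subgroup_iff:
  assumes D: "D \<in> carrier (Div0 J)"
  shows "pic_class D \<in> apex_subgroup \<longleftrightarrow>
    reduced (restrict_G D) \<in> column_lattice (shifted_reduced_laplacian (int (Suc l)))"
proof -
  have "pic_class D \<in> apex_subgroup \<longleftrightarrow> (\<exists>a. pic_class D = pic_class (apex_div a))"
  proof
    assume "\<exists>a. pic_class D = pic_class (apex_div a)"
    then obtain a where a: "pic_class D = pic_class (apex_div a)" by blast
    \<comment> \<open>Reduction gives canonical residues, and the restriction to
      \<open>{..<l}\<close> makes the function extensional, as the carrier of the product
      requires.\<close>
    define b where "b = (\<lambda>i\<in>{..<l}. a i mod size_J)"
    have "pic_class (apex_div a) = pic_class (apex_div b)"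
      by (rule pic_class_apex_div_eqI) (simp add: b_def)
    moreover have "b \<in> carrier apex_group"
      by (auto simp: b_def size_J_def carrier_integer_mod_group)
    ultimately show "pic_class D \<in> apex_subgroup" unfolding apex_subgroup_def a by blast
  qed (auto simp: apex_subgroup_def)
  also have "\<dots> \<longleftrightarrow> (\<exists>a. \<exists>E\<in>carrier (Div J). D - apex_div a = laplacian J E)"
    unfolding pic_class_eq_iff[OF D apex_div_Div0] by blast
  also have "\<dots> \<longleftrightarrow> (\<exists>a. \<exists>E\<in>carrier (Div J). D = apex_div a + laplacian J E)"
    by (simp add: diff_eq_eq add.commute)
  finally show ?thesis unfolding reduced_in_lattice_iff[OF D] .
qed

text \<open>Restriction to \<open>G\<close> matches the cosets of the apex subgroup with the integer
  vectors modulo the column lattice, so lifts of a transversal of size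
  \<open>\<bar>det\<bar>\<close> represent each coset once.\<close>

lemma card_Pic0_Mod_apex_subgroup:
  "finite (carrier (Pic0 J Mod apex_subgroup))"
  "int (card (carrier (Pic0 J Mod apex_subgroup)))
     = \<bar>det (shifted_reduced_laplacian (int (Suc l)))\<bar>"
proof -
  let ?L = "column_lattice (shifted_reduced_laplacian (int (Suc l)))"
  obtain T where T: "transversal m ?L T"
      "int (card T) = \<bar>det (shifted_reduced_laplacian (int (Suc l)))\<bar>"
    using exists_transversal_det[OF shifted_reduced_laplacian_carrier
        det_shifted_reduced_laplacian_nonzero, of "int (Suc l)"] by auto
  have Tc: "\<And>t. t \<in> T \<Longrightarrow> t \<in> carrier_vec m"
    and Tu: "\<And>x. x \<in> carrier_vec m \<Longrightarrow> \<exists>!t. t \<in> T \<and> x - t \<in> ?L"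
    using T(1) by (auto simp: transversal_def)
  interpret D: comm_group "Div0 J" by (rule comm_group_Div0)
  interpret A: comm_group apex_group by (rule comm_group_apex_group)
  interpret P: comm_group "Pic0 J" by (rule comm_group_Pic0)
  interpret h: group_hom "Div0 J" "Pic0 J" pic_class by (rule group_hom_pic_class)
  interpret f: group_hom apex_group "Pic0 J" "\<lambda>a. pic_class (apex_div a)"
    using apex_group_mon by unfold_locales (simp add: mon_def)
  have sub: "subgroup apex_subgroup (Pic0 J)" unfolding apex_subgroup_def by (rule f.img_is_subgroup)
  interpret q: group_hom "Pic0 J" "Pic0 J Mod apex_subgroup" "\<lambda>x. apex_subgroup #>\<^bsub>Pic0 J\<^esub> x"
    by (rule P.group_hom_quotient[OF sub])
  define cls where "cls D = apex_subgroup #>\<^bsub>Pic0 J\<^esub> pic_class D" for D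
  have cls_eq: "cls D = cls E \<longleftrightarrow> reduced (restrict_G D) - reduced (restrict_G E) \<in> ?L"
    if DE: "D \<in> carrier (Div0 J)" "E \<in> carrier (Div0 J)" for D E
  proof -
    have diff: "D \<otimes>\<^bsub>Div0 J\<^esub> inv\<^bsub>Div0 J\<^esub> E = D - E" using DE by simp
    have DmE: "D - E \<in> carrier (Div0 J)"
      unfolding diff[symmetric] using DE by (intro D.m_closed D.inv_closed)
    have "pic_class (D - E) = pic_class D \<otimes>\<^bsub>Pic0 J\<^esub> inv\<^bsub>Pic0 J\<^esub> pic_class E"
      unfolding diff[symmetric] using DE by (simp del: mult_Div0 inv_Div0)
    hence "cls D = cls E \<longleftrightarrow> pic_class (D - E) \<in> apex_subgroup"
      using q.hom_eq_iff[OF h.hom_closed h.hom_closed, OF DE]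
        P.rcos_eq_one_iff[OF sub h.hom_closed[OF DmE]] by (simp add: cls_def)
    also have "\<dots> \<longleftrightarrow> reduced (restrict_G (D - E)) \<in> ?L"
      by (rule pic_class_in_apex_subgroup_iff[OF DmE])
    also have "reduced (restrict_G (D - E)) = reduced (restrict_G D) - reduced (restrict_G E)"
      by (simp add: lookup_minus reduced_diff)
    finally show ?thesis .
  qed
  have "\<forall>t\<in>T. \<exists>D. D \<in> carrier (Div0 J) \<and> reduced (restrict_G D) = t"
    using reduced_restrict_surj Tc by metis
  then obtain lift where lift: "\<And>t. t \<in> T \<Longrightarrow> lift t \<in> carrier (Div0 J)"
      "\<And>t. t \<in> T \<Longrightarrow> reduced (restrict_G (lift t)) = t"
    by metis
  have bij: "bij_betw (\<lambda>t. cls (lift t)) T (carrier (Pic0 J Mod apex_subgroup))"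
    unfolding bij_betw_def
  proof
    show "inj_on (\<lambda>t. cls (lift t)) T"
    proof (rule inj_onI)
      fix s t assume st: "s \<in> T" "t \<in> T" "cls (lift s) = cls (lift t)"
      hence "s - t \<in> ?L" using cls_eq[OF lift(1) lift(1)] lift(2) by metis
      \<comment> \<open>Equal arguments in \<open>cls_eq\<close> put \<open>s - s\<close> in the
        lattice, so \<open>s\<close> and \<open>t\<close> both represent \<open>s\<close> and
        uniqueness applies.\<close>
      moreover have "cls (lift s) = cls (lift s)" ..
      hence "s - s \<in> ?L" using cls_eq[OF lift(1) lift(1)] lift(2) st(1) by metis
      ultimately show "s = t" using Tu[OF Tc[OF st(1)]] st by blast
    qed
    show "(\<lambda>t. cls (lift t)) ` T = carrier (Pic0 J Mod apex_subgroup)"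
    proof (intro equalityI subsetI)
      fix X assume "X \<in> carrier (Pic0 J Mod apex_subgroup)"
      then obtain D where D: "D \<in> carrier (Div0 J)" "X = cls D"
        by (auto simp: carrier_FactGroup carrier_Pic0 cls_def)
      obtain t where t: "t \<in> T" "reduced (restrict_G D) - t \<in> ?L"
        using Tu[OF reduced_carrier] by blast
      hence "cls D = cls (lift t)" using cls_eq[OF D(1) lift(1)] lift(2) by simp
      thus "X \<in> (\<lambda>t. cls (lift t)) ` T" using D t by blast
    qed (auto simp: cls_def carrier_FactGroup carrier_Pic0 lift)
  qed
  show "finite (carrier (Pic0 J Mod apex_subgroup))"
    using bij_betw_finite[OF bij] T(1) by (simp add: transversal_def)
  show "int (card (carrier (Pic0 J Mod apex_subgroup)))
     = \<bar>det (shifted_reduced_laplacian (int (Suc l)))\<bar>"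
    using bij_betw_same_card[OF bij] T(2) by simp
qed

end

theorem theoremA:
  fixes \<Gamma> :: "'a pair_pre_digraph" and K :: "'b pair_pre_digraph" and n k :: nat
  assumes "pair_graph \<Gamma>"
    and "Digraph_Component.connected (with_proj \<Gamma>)"
    and "card (pverts \<Gamma>) = k" and "k \<ge> 1"
    and "n \<ge> 1" and "complete_digraph n (with_proj K)"
  shows "\<exists>(H :: ('a + 'b \<Rightarrow>\<^sub>0 int) set set monoid) f g.
           short_exact_comm_groups
             (product_group {..<n - 1} (\<lambda>_. integer_mod_group (n + k))) f
             (Pic0 (graph_join \<Gamma> K)) g
             H
           \<and> finite (carrier H)
           \<and> of_nat (Coset.order H) = \<bar>poly (laplacian_char_poly \<Gamma>) (- of_nat n)\<bar>"
proof -
  interpret pair_graph \<Gamma> by fact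
  \<comment> \<open>Both numberings start at 0 and need a base vertex, which
    \<open>k \<ge> 1\<close> and \<open>n \<ge> 1\<close> provide; the exponent \<open>n - 1\<close>
    becomes \<open>l\<close>.\<close>
  obtain m l where ml: "k = Suc m" "n = Suc l"
    using assms(4,5) by (metis Suc_le_D One_nat_def)
  obtain v where v: "bij_betw v {..m} (pverts \<Gamma>)"
    using ex_bij_betw_nat_finite[OF pair_finite_verts] assms(3) ml
    by (auto simp: atLeast0LessThan lessThan_Suc_atMost)
  obtain w where w: "bij_betw w {..l} (pverts K)"
    using ex_bij_betw_nat_finite[OF complete_pair_digraph(2)[OF assms(6)]]
      complete_pair_digraph(3)[OF assms(6)] ml by (auto simp: atLeast0LessThan lessThan_Suc_atMost)
  interpret cone \<Gamma> v m K w l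
    using v w assms(6) ml by unfold_locales auto
  let ?f = "\<lambda>a. pic_class (apex_div a)"
  let ?H = "Pic0 J Mod apex_subgroup"
  have "short_exact_comm_groups (product_group {..<n - 1} (\<lambda>_. integer_mod_group (n + k))) ?f
      (Pic0 J) (\<lambda>x. apex_subgroup #>\<^bsub>Pic0 J\<^esub> x) ?H"
    using short_exact_quotient[OF comm_group_apex_group comm_group_Pic0 apex_group_mon]
    by (simp add: ml apex_subgroup_def)
  moreover have "of_nat (Coset.order ?H) = \<bar>poly (laplacian_char_poly \<Gamma>) (- of_nat n)\<bar>"
  proof -
    have "\<bar>poly (laplacian_char_poly \<Gamma>) (- of_int (int (Suc l)))\<bar>
        = of_int (int (card (carrier ?H)))"
      unfolding char_poly_shifted_reduced_laplacian card_Pic0_Mod_apex_subgroup(2) ..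
    thus ?thesis unfolding ml(2) by (simp add: Coset.order_def)
  qed
  ultimately show ?thesis using card_Pic0_Mod_apex_subgroup(1) by blast
qed

end
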